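(* Let $G=(X,w,\kappa,\mu)$ be a connected graph. Fix $1\le p<\infty$, and if $p>1$ assume that $\sum_{y\in X}\frac{w(x,y)^p}{\mu(y)^{p-1}}<\infty$ for every $x\in X$. Let $q\in(0,1)\cup(1,+\infty)$, let $u_0\in\ell^p(X,\mu)\cap\ell^\infty(X,\mu)$ with $u_0\ge0$, and let $u$ be the unique mild solution of $$\partial_tu+\Delta u+|u|^{q-1}u=0\ \text{ in }(0,+\infty)\times X,\qquad u(0)=u_0\ \text{ in }X.$$ Set $M:=\|u_0\|_\infty$. Then: 1) if $q\in(0,1)$, then $0\le u(t,x)\le\bigl[M^{1-q}-(1-q)t\bigr]_+^{\frac1{1-q}}$ for all $(t,x)\in(0,+\infty)\times X$; 2) if $q\in(1,+\infty)$ and $u_0\not\equiv0$, then $0<u(t,x)\le\bigl[\frac1{M^{q-1}}+(q-1)t\bigr]^{-\frac1{q-1}}$ for all $(t,x)\in(0,+\infty)\times X$. Therefore, if $q\in(0,1)$, then $u(t,\cdot)\equiv0$ for all $t\ge T_*:=\dfrac{M^{1-q}}{1-q}$.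
   Context: A graph $G=(X,w,\kappa,\mu)$ consists of a countable set $X$ (nodes), an edge-weight $w:X\times X\to[0,\infty)$ with $w(x,y)=w(y,x)$, $w(x,x)=0$ and $\sum_{y\in X}w(x,y)<\infty$ for all $x,y\in X$, a killing term $\kappa:X\to[0,\infty)$, and a node measure $\mu:X\to(0,\infty)$. Write $x\sim y$ iff $w(x,y)>0$; $G$ is connected if any two nodes $x,y$ are joined by a finite sequence $x=x_0\sim x_1\sim\dots\sim x_n=y$. $C(X)$ is the set of real functions on $X$; $\ell^p(X,\mu)=\{u\in C(X):\sum_x|u(x)|^p\mu(x)<\infty\}$ with norm $\|u\|_p=(\sum_x|u(x)|^p\mu(x))^{1/p}$; $\ell^\infty(X,\mu)$ is the space of bounded functions with $\|u\|_\infty=\sup_x|u(x)|$. $[s]_+=\max\{s,0\}$. The formal graph Laplacian $\Delta$ has domain $\operatorname{dom}(\Delta)=\{u\in C(X):\sum_{y}w(x,y)|u(y)|<\infty\ \forall x\in X\}$ and acts by $$\Delta u(x)=\frac1{\mu(x)}\sum_{y\in X}w(x,y)(u(x)-u(y))+\frac{\kappa(x)}{\mu(x)}u(x).$$ Here $\mathcal Au=\Delta u+|u|^{q-1}u$ (with $|s|^{q-1}s:=0$ at $s=0$) and $\operatorname{dom}_p(\mathcal A)=\{u\in\ell^p(X,\mu): u\in\operatorname{dom}(\Delta),\ \mathcal Au\in\ell^p(X,\mu)\}$; the problem is $\partial_tu+\mathcal Au=h$, $u(0)=u_0$, with $h=0$. Mild solutions. On a finite interval $[0,T]$: for $\epsilon>0$,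 an $\epsilon$-discretization of $([0,T];h)$ is a partition $0=t_0<\dots<t_N\le T$ together with $h_1,\dots,h_N\in\ell^p(X,\mu)$ such that $t_k-t_{k-1}\le\epsilon$ for all $k$, $T-t_N\le\epsilon$ and $\sum_{k=1}^N\int_{t_{k-1}}^{t_k}\|h(t)-h_k\|_p\,dt\le\epsilon$. If there are $u_1,\dots,u_N\in\operatorname{dom}_p(\mathcal A)$ with $(\operatorname{id}+\lambda_k\mathcal A)u_k=u_{k-1}+\lambda_kh_k$, $\lambda_k=t_k-t_{k-1}$ (starting from $u_0$), the corresponding $\epsilon$-approximate solution is $u_\epsilon(0)=u_0$, $u_\epsilon(t)=u_k$ for $t\in(t_{k-1},t_k]$. A mild solution on $[0,T]$ is $u\in C([0,T];\ell^p(X,\mu))$ such that for every $\epsilon>0$ there are an $\epsilon$-discretization and an $\epsilon$-approximate solution $u_\epsilon$ subordinate to it with $\|u(t)-u_\epsilon(t)\|_p<\epsilon$ for all $t\in[0,t_N]$. A mild solution on $[0,+\infty)$ is a function whose restriction to each compact interval $[0,a]$ is a mild solution on $[0,a]$. *)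

theory Defs
  imports "HOL-Analysis.Analysis"
begin

text \<open>The node set is the whole (nonempty, countable) type. Since unconditional summability in
  \<open>real\<close> is absolute summability, \<open>summable_on\<close> renders all summability conditions below.\<close>

definition weighted_graph ::
    "('a::countable \<Rightarrow> 'a \<Rightarrow> real) \<Rightarrow> ('a \<Rightarrow> real) \<Rightarrow> ('a \<Rightarrow> real) \<Rightarrow> bool" where
  "weighted_graph w \<kappa> \<mu> \<longleftrightarrow>
     (\<forall>x y. 0 \<le> w x y) \<and> (\<forall>x y. w x y = w y x) \<and> (\<forall>x. w x x = 0) \<and>
     (\<forall>x. (\<lambda>y. w x y) summable_on UNIV) \<and> (\<forall>x. 0 \<le> \<kappa> x) \<and> (\<forall>x. 0 < \<mu> x)"

definition graph_connected :: "('a::countable \<Rightarrow> 'a \<Rightarrow> real) \<Rightarrow> bool" where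
  "graph_connected w \<longleftrightarrow> (\<forall>x y. (\<lambda>a b. 0 < w a b)\<^sup>*\<^sup>* x y)"

definition lp_space :: "real \<Rightarrow> ('a::countable \<Rightarrow> real) \<Rightarrow> ('a \<Rightarrow> real) set" where
  "lp_space p \<mu> = {u. (\<lambda>x. \<bar>u x\<bar> powr p * \<mu> x) summable_on UNIV}"

definition lp_norm :: "real \<Rightarrow> ('a::countable \<Rightarrow> real) \<Rightarrow> ('a \<Rightarrow> real) \<Rightarrow> real" where
  "lp_norm p \<mu> u = (\<Sum>\<^sub>\<infinity>x. \<bar>u x\<bar> powr p * \<mu> x) powr (1 / p)"

definition linf_space :: "('a::countable \<Rightarrow> real) set" where
  "linf_space = {u. bounded (range u)}"

definition linf_norm :: "('a::countable \<Rightarrow> real) \<Rightarrow> real" where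
  "linf_norm u = (SUP x. \<bar>u x\<bar>)"

definition laplacian_dom :: "('a::countable \<Rightarrow> 'a \<Rightarrow> real) \<Rightarrow> ('a \<Rightarrow> real) set" where
  "laplacian_dom w = {u. \<forall>x. (\<lambda>y. w x y * \<bar>u y\<bar>) summable_on UNIV}"

definition laplacian ::
    "('a::countable \<Rightarrow> 'a \<Rightarrow> real) \<Rightarrow> ('a \<Rightarrow> real) \<Rightarrow> ('a \<Rightarrow> real) \<Rightarrow> ('a \<Rightarrow> real) \<Rightarrow> 'a \<Rightarrow> real" where
  "laplacian w \<kappa> \<mu> u x =
     1 / \<mu> x * (\<Sum>\<^sub>\<infinity>y. w x y * (u x - u y)) + \<kappa> x / \<mu> x * u x"

definition op_A ::
    "('a::countable \<Rightarrow> 'a \<Rightarrow> real) \<Rightarrow> ('a \<Rightarrow> real) \<Rightarrow> ('a \<Rightarrow> real) \<Rightarrow> real \<Rightarrow> ('a \<Rightarrow> real) \<Rightarrow> 'a \<Rightarrow> real" where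
  "op_A w \<kappa> \<mu> q u x = laplacian w \<kappa> \<mu> u x + \<bar>u x\<bar> powr (q - 1) * u x"

definition op_A_dom ::
    "('a::countable \<Rightarrow> 'a \<Rightarrow> real) \<Rightarrow> ('a \<Rightarrow> real) \<Rightarrow> ('a \<Rightarrow> real) \<Rightarrow> real \<Rightarrow> real \<Rightarrow> ('a \<Rightarrow> real) set" where
  "op_A_dom w \<kappa> \<mu> p q =
     {u. u \<in> lp_space p \<mu> \<and> u \<in> laplacian_dom w \<and> op_A w \<kappa> \<mu> q u \<in> lp_space p \<mu>}"

text \<open>A discretization is given by the number of steps \<open>N\<close>, the partition points
  \<open>t 0, \<dots>, t N\<close> and the functions \<open>hs 1, \<dots>, hs N\<close>; other values of \<open>t\<close> and \<open>hs\<close> are irrelevant.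
  The integrands are nonnegative, so the error is measured by the nonnegative integral.\<close>

definition eps_discretization ::
    "('a::countable \<Rightarrow> real) \<Rightarrow> real \<Rightarrow> real \<Rightarrow> (real \<Rightarrow> 'a \<Rightarrow> real) \<Rightarrow> real \<Rightarrow>
     nat \<Rightarrow> (nat \<Rightarrow> real) \<Rightarrow> (nat \<Rightarrow> 'a \<Rightarrow> real) \<Rightarrow> bool" where
  "eps_discretization \<mu> p T h \<epsilon> N t hs \<longleftrightarrow>
     1 \<le> N \<and> t 0 = 0 \<and> (\<forall>k\<in>{1..N}. t (k - 1) < t k) \<and> t N \<le> T \<and>
     (\<forall>k\<in>{1..N}. hs k \<in> lp_space p \<mu>) \<and>
     (\<forall>k\<in>{1..N}. t k - t (k - 1) \<le> \<epsilon>) \<and> T - t N \<le> \<epsilon> \<and>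
     (\<Sum>k=1..N. \<integral>\<^sup>+s\<in>{t (k - 1)..t k}. ennreal (lp_norm p \<mu> (\<lambda>x. h s x - hs k x)) \<partial>lborel)
       \<le> ennreal \<epsilon>"

text \<open>The function \<open>v\<close> is a step function on \<open>[0, t N]\<close>; its values elsewhere are irrelevant.\<close>

definition approx_solution ::
    "('a::countable \<Rightarrow> 'a \<Rightarrow> real) \<Rightarrow> ('a \<Rightarrow> real) \<Rightarrow> ('a \<Rightarrow> real) \<Rightarrow> real \<Rightarrow> real \<Rightarrow> ('a \<Rightarrow> real) \<Rightarrow>
     nat \<Rightarrow> (nat \<Rightarrow> real) \<Rightarrow> (nat \<Rightarrow> 'a \<Rightarrow> real) \<Rightarrow> (real \<Rightarrow> 'a \<Rightarrow> real) \<Rightarrow> bool" where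
  "approx_solution w \<kappa> \<mu> p q u0 N t hs v \<longleftrightarrow>
     (\<exists>us :: nat \<Rightarrow> 'a \<Rightarrow> real.
        us 0 = u0 \<and>
        (\<forall>k\<in>{1..N}. us k \<in> op_A_dom w \<kappa> \<mu> p q \<and>
           (\<forall>x. us k x + (t k - t (k - 1)) * op_A w \<kappa> \<mu> q (us k) x
                = us (k - 1) x + (t k - t (k - 1)) * hs k x)) \<and>
        v 0 = u0 \<and>
        (\<forall>k\<in>{1..N}. \<forall>s\<in>{t (k - 1)<..t k}. v s = us k))"

text \<open>The estimate at time \<open>0\<close>, for all \<open>\<epsilon>\<close>, contains the initial condition \<open>u 0 = u0\<close>.\<close>

definition mild_solution_on ::
    "('a::countable \<Rightarrow> 'a \<Rightarrow> real) \<Rightarrow> ('a \<Rightarrow> real) \<Rightarrow> ('a \<Rightarrow> real) \<Rightarrow> real \<Rightarrow> real \<Rightarrow>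
     (real \<Rightarrow> 'a \<Rightarrow> real) \<Rightarrow> ('a \<Rightarrow> real) \<Rightarrow> real \<Rightarrow> (real \<Rightarrow> 'a \<Rightarrow> real) \<Rightarrow> bool" where
  "mild_solution_on w \<kappa> \<mu> p q h u0 T u \<longleftrightarrow>
     (\<forall>s\<in>{0..T}. h s \<in> lp_space p \<mu>) \<and>
     (\<forall>s\<in>{0..T}. u s \<in> lp_space p \<mu>) \<and>
     (\<forall>s\<in>{0..T}. ((\<lambda>r. lp_norm p \<mu> (\<lambda>x. u r x - u s x)) \<longlongrightarrow> 0) (at s within {0..T})) \<and>
     (\<forall>\<epsilon>>0. \<exists>N t hs v.
        eps_discretization \<mu> p T h \<epsilon> N t hs \<and>
        approx_solution w \<kappa> \<mu> p q u0 N t hs v \<and>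
        (\<forall>s\<in>{0..t N}. lp_norm p \<mu> (\<lambda>x. u s x - v s x) < \<epsilon>))"

definition mild_solution ::
    "('a::countable \<Rightarrow> 'a \<Rightarrow> real) \<Rightarrow> ('a \<Rightarrow> real) \<Rightarrow> ('a \<Rightarrow> real) \<Rightarrow> real \<Rightarrow> real \<Rightarrow>
     (real \<Rightarrow> 'a \<Rightarrow> real) \<Rightarrow> ('a \<Rightarrow> real) \<Rightarrow> (real \<Rightarrow> 'a \<Rightarrow> real) \<Rightarrow> bool" where
  "mild_solution w \<kappa> \<mu> p q h u0 u \<longleftrightarrow> (\<forall>a>0. mild_solution_on w \<kappa> \<mu> p q h u0 a u)"

text \<open>Functions of time are total on \<open>real\<close>, so uniqueness refers to their values on \<open>[0, \<infinity>)\<close>.\<close>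

definition unique_mild_solution ::
    "('a::countable \<Rightarrow> 'a \<Rightarrow> real) \<Rightarrow> ('a \<Rightarrow> real) \<Rightarrow> ('a \<Rightarrow> real) \<Rightarrow> real \<Rightarrow> real \<Rightarrow>
     (real \<Rightarrow> 'a \<Rightarrow> real) \<Rightarrow> ('a \<Rightarrow> real) \<Rightarrow> (real \<Rightarrow> 'a \<Rightarrow> real) \<Rightarrow> bool" where
  "unique_mild_solution w \<kappa> \<mu> p q h u0 u \<longleftrightarrow>
     mild_solution w \<kappa> \<mu> p q h u0 u \<and>
     (\<forall>v. mild_solution w \<kappa> \<mu> p q h u0 v \<longrightarrow> (\<forall>t\<ge>0. v t = u t))"

end

theory Submission
  imports Defs
begin

text \<open>
  On a graph where mass may enter from infinity, the operator \<open>A u = \<Delta> u + u powr q\<close>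
  with its maximal domain need not be accretive, and then a mild solution cannot be compared with other
  functions directly. The assumed uniqueness removes the difficulty: it suffices to construct one mild
  solution that satisfies the bounds. The one constructed is the minimal solution, which receives nothing
  from infinity.

  The construction is that of Crandall and Liggett. For bounded nonnegative \<open>f\<close> in
  \<open>\<ell>\<^sup>p\<close> let \<open>res l f\<close> be the minimal nonnegative solution
  \<open>v\<close> of \<open>v + l A v = f\<close>, the increasing limit of an explicit iteration.
  Minimality gives comparison with supersolutions and the resolvent identity
  (\<open>res_resolvent_identity\<close>). The iteration itself gives contractivity in
  \<open>\<ell>\<^sup>p\<close> (\<open>res_contraction\<close>): the \<open>p\<close>-th power of the
  difference of two iterates is dominated, by Jensen's inequality, by a linear iteration which does not
  create mass. Contractivity and the resolvent identity imply the two-parameter recursion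
  \<open>two_step_inequality\<close> for the distance of two implicit Euler schemes with different steps,
  and \<open>double_sequence_bound\<close> solves it. Hence the schemes converge, uniformly on compact time
  intervals, to a mild solution (\<open>flow_mild_solution\<close>), the scheme itself providing the
  approximate solutions.

  The bounds are proved for the scheme and survive the limit. Constants \<open>c\<close> with \<open>f \<le>
  c + l c powr q\<close> are supersolutions, so the scheme stays below the implicit Euler scheme of
  \<open>y' = - y powr q\<close>, \<open>y 0 = M\<close>. The function \<open>s powr (1 - q) / (1 -
  q)\<close> of the latter decreases at a speed of at least a number that tends to one as the step length
  tends to zero (\<open>scalar_euler_clock\<close>), and in the limit this is the bound by the explicit
  solution of the differential equation. For \<open>q < 1\<close> it becomes extinct at the stated time. For
  \<open>q > 1\<close> the absorption is dominated by a linear term, so that positive values stay positive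
  and propagate along edges; connectedness does the rest (\<open>flow_positive\<close>).
\<close>

section \<open>The \<open>\<ell>\<^sup>p\<close> norm\<close>

text \<open>Convexity of \<open>x \<mapsto> x powr p\<close> as a supporting line, the form that can be summed against weights. It
  includes \<open>a = 0\<close>, where the line is the zero function, because \<open>0 powr (p - 1) = 0\<close> even for \<open>p = 1\<close>.\<close>

lemma powr_tangent_le:
  fixes a b p :: real
  assumes "1 \<le> p" "0 \<le> a" "0 \<le> b"
  shows "a powr p + p * a powr (p - 1) * (b - a) \<le> b powr p"
proof -
  consider "a = 0" | "a > 0" "b = 0" | "a > 0" "b > 0"
    using assms by linarith
  then show ?thesis
  proof cases
    case 1
    then show ?thesis by simp
  next
    case 2
    then have "p * a powr (p - 1) * a = p * a powr p"
      using powr_mult_base[of a "p - 1"] by (simp add: mult.commute mult.left_commute)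
    moreover have "1 * a powr p \<le> p * a powr p"
      using assms by (intro mult_right_mono) auto
    ultimately show ?thesis using 2 by (simp add: algebra_simps)
  next
    case 3
    have "p * a powr (p - 1) * (b - a) \<le> b powr p - a powr p"
    proof (rule convex_on_imp_above_tangent[where A = "{0<..}"])
      show "convex_on {0<..} (\<lambda>x. x powr p)"
        using assms by (intro powr_convex)
      show "((\<lambda>x. x powr p) has_field_derivative p * a powr (p - 1)) (at a within {0<..})"
        using 3 by (auto intro!: derivative_eq_intros)
    qed (use 3 in \<open>auto simp: interior_open\<close>)
    then show ?thesis by simp
  qed
qed

lemma powr_convex_combination:
  fixes a b p t :: real
  assumes "1 \<le> p" "0 \<le> a" "0 \<le> b" "0 \<le> t" "t \<le> 1"
  shows "(t * a + (1 - t) * b) powr p \<le> t * a powr p + (1 - t) * b powr p"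
proof -
  define c where "c = t * a + (1 - t) * b"
  have c: "0 \<le> c" unfolding c_def using assms by simp
  have A: "t * (c powr p + p * c powr (p - 1) * (a - c)) \<le> t * a powr p"
    using assms c by (intro mult_left_mono powr_tangent_le) auto
  have B: "(1 - t) * (c powr p + p * c powr (p - 1) * (b - c)) \<le> (1 - t) * b powr p"
    using assms c by (intro mult_left_mono powr_tangent_le) auto
  have Z: "t * (a - c) + (1 - t) * (b - c) = 0"
    unfolding c_def by (simp add: algebra_simps)
  have "t * (c powr p + p * c powr (p - 1) * (a - c))
      + (1 - t) * (c powr p + p * c powr (p - 1) * (b - c))
      = c powr p + p * c powr (p - 1) * (t * (a - c) + (1 - t) * (b - c))"
    by (simp add: algebra_simps)
  also have "\<dots> = c powr p" using Z by simp
  finally show ?thesis using A B unfolding c_def by linarith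
qed

lemma lp_norm_nonneg [simp]: "0 \<le> lp_norm p \<mu> u"
  by (simp add: lp_norm_def)

text \<open>Membership and norm bound together are one family of inequalities about finite sums. Minkowski's
  inequality and Fatou's lemma below thereby become statements about finite sums, with no
  separate discussion of summability.\<close>

lemma lp_bound_iff_finite_sums:
  fixes \<mu> u :: "'a::countable \<Rightarrow> real"
  assumes p: "1 \<le> p" and \<mu>: "\<And>x. 0 < \<mu> x" and C: "0 \<le> C"
  shows "(u \<in> lp_space p \<mu> \<and> lp_norm p \<mu> u \<le> C) \<longleftrightarrow>
    (\<forall>F. finite F \<longrightarrow> (\<Sum>x\<in>F. \<bar>u x\<bar> powr p * \<mu> x) \<le> C powr p)"
    (is "?L \<longleftrightarrow> ?R")
proof -
  let ?g = "\<lambda>x. \<bar>u x\<bar> powr p * \<mu> x"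
  have g: "0 \<le> ?g x" for x using \<mu>[of x] by simp
  have iff: "lp_norm p \<mu> u \<le> C \<longleftrightarrow> infsum ?g UNIV \<le> C powr p"
  proof -
    have 0: "0 \<le> infsum ?g UNIV" using g by (intro infsum_nonneg) auto
    have "(infsum ?g UNIV powr (1 / p)) powr p = infsum ?g UNIV" "(C powr p) powr (1 / p) = C"
      using 0 p C by (auto simp: powr_powr)
    then show ?thesis
      unfolding lp_norm_def
      using powr_mono2[of p "infsum ?g UNIV powr (1 / p)" C]
        powr_mono2[of "1 / p" "infsum ?g UNIV" "C powr p"] 0 p C by auto
  qed
  show ?thesis
  proof
    assume L: ?L
    then have s: "?g summable_on UNIV" by (simp add: lp_space_def)
    show ?R
    proof (intro allI impI)
      fix F :: "'a set" assume "finite F"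
      then have "sum ?g F \<le> infsum ?g UNIV"
        using s g by (intro finite_sum_le_infsum) auto
      also have "\<dots> \<le> C powr p" using L iff by simp
      finally show "sum ?g F \<le> C powr p" .
    qed
  next
    assume R: ?R
    then have s: "?g summable_on UNIV"
      using g by (intro nonneg_bdd_above_summable_on) (auto intro!: bdd_aboveI[of _ "C powr p"])
    moreover have "infsum ?g UNIV \<le> C powr p"
      using s R by (intro infsum_le_finite_sums) auto
    ultimately show ?L using iff by (simp add: lp_space_def)
  qed
qed

lemma lp_fatou:
  fixes \<mu> :: "'a::countable \<Rightarrow> real" and z :: "nat \<Rightarrow> 'a \<Rightarrow> real"
  assumes p: "1 \<le> p" and \<mu>: "\<And>x. 0 < \<mu> x" and C: "0 \<le> C"
    and lim: "\<And>x. (\<lambda>n. z n x) \<longlonglongrightarrow> u x"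
    and bd: "\<forall>\<^sub>F n in sequentially. z n \<in> lp_space p \<mu> \<and> lp_norm p \<mu> (z n) \<le> C"
  shows "u \<in> lp_space p \<mu> \<and> lp_norm p \<mu> u \<le> C"
proof (subst lp_bound_iff_finite_sums[where \<mu> = \<mu>, OF p \<mu> C], intro allI impI)
  fix F :: "'a set" assume F: "finite F"
  show "(\<Sum>x\<in>F. \<bar>u x\<bar> powr p * \<mu> x) \<le> C powr p"
  proof (rule tendsto_upperbound)
    show "(\<lambda>n. \<Sum>x\<in>F. \<bar>z n x\<bar> powr p * \<mu> x) \<longlonglongrightarrow> (\<Sum>x\<in>F. \<bar>u x\<bar> powr p * \<mu> x)"
      using p by (intro tendsto_intros lim tendsto_powr2) auto
    show "\<forall>\<^sub>F n in sequentially. (\<Sum>x\<in>F. \<bar>z n x\<bar> powr p * \<mu> x) \<le> C powr p"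
      using bd
    proof eventually_elim
      case (elim n)
      then show ?case using F by (simp only: lp_bound_iff_finite_sums[where \<mu> = \<mu>, OF p \<mu> C])
    qed
  qed simp
qed

text \<open>Minkowski's inequality: \<open>(u + v) / (A + B)\<close> is a convex combination of \<open>u / A\<close> and \<open>v / B\<close>, and
  the unit ball is convex. Strict bounds keep \<open>A\<close> and \<open>B\<close> positive.\<close>

lemma lp_bound_add:
  fixes \<mu> u v :: "'a::countable \<Rightarrow> real"
  assumes p: "1 \<le> p" and \<mu>: "\<And>x. 0 < \<mu> x"
    and u: "u \<in> lp_space p \<mu>" and v: "v \<in> lp_space p \<mu>"
    and A: "lp_norm p \<mu> u < A" and B: "lp_norm p \<mu> v < B"
  shows "(\<lambda>x. u x + v x) \<in> lp_space p \<mu> \<and> lp_norm p \<mu> (\<lambda>x. u x + v x) \<le> A + B"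
proof -
  have A0: "0 < A" and B0: "0 < B"
    using A B lp_norm_nonneg[of p \<mu> u] lp_norm_nonneg[of p \<mu> v] by linarith+
  define t where "t = A / (A + B)"
  have t: "0 \<le> t" "t \<le> 1" "1 - t = B / (A + B)"
    using A0 B0 by (auto simp: t_def field_simps)
  have "(\<Sum>x\<in>F. \<bar>u x + v x\<bar> powr p * \<mu> x) \<le> (A + B) powr p" if F: "finite F" for F
  proof -
    have U: "(\<Sum>x\<in>F. \<bar>u x\<bar> powr p * \<mu> x) \<le> A powr p"
      using lp_bound_iff_finite_sums[where \<mu> = \<mu>, OF p \<mu>, of A u] A0 A u F by auto
    have V: "(\<Sum>x\<in>F. \<bar>v x\<bar> powr p * \<mu> x) \<le> B powr p"
      using lp_bound_iff_finite_sums[where \<mu> = \<mu>, OF p \<mu>, of B v] B0 B v F by auto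
    have pt: "\<bar>u x + v x\<bar> powr p * \<mu> x
        \<le> (A + B) powr p * (t / A powr p * (\<bar>u x\<bar> powr p * \<mu> x)
            + (1 - t) / B powr p * (\<bar>v x\<bar> powr p * \<mu> x))" for x
    proof -
      have "\<bar>u x + v x\<bar> \<le> (A + B) * (t * (\<bar>u x\<bar> / A) + (1 - t) * (\<bar>v x\<bar> / B))"
      proof -
        have "(A + B) * (t * (\<bar>u x\<bar> / A)) = \<bar>u x\<bar>" "(A + B) * ((1 - t) * (\<bar>v x\<bar> / B)) = \<bar>v x\<bar>"
          unfolding t(3) unfolding t_def using A0 B0 by auto
        then show ?thesis
          using abs_triangle_ineq[of "u x" "v x"] by (simp add: distrib_left)
      qed
      then have "\<bar>u x + v x\<bar> powr p
          \<le> ((A + B) * (t * (\<bar>u x\<bar> / A) + (1 - t) * (\<bar>v x\<bar> / B))) powr p"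
        using p by (intro powr_mono2) auto
      also have "\<dots> = (A + B) powr p * (t * (\<bar>u x\<bar> / A) + (1 - t) * (\<bar>v x\<bar> / B)) powr p"
        by (rule powr_mult)
      also have "\<dots> \<le> (A + B) powr p
          * (t * (\<bar>u x\<bar> / A) powr p + (1 - t) * (\<bar>v x\<bar> / B) powr p)"
        using A0 B0 t p by (intro mult_left_mono powr_convex_combination) auto
      also have "\<dots> = (A + B) powr p
          * (t / A powr p * \<bar>u x\<bar> powr p + (1 - t) / B powr p * \<bar>v x\<bar> powr p)"
        using A0 B0 by (simp add: powr_divide)
      finally have "\<bar>u x + v x\<bar> powr p * \<mu> x \<le> ((A + B) powr p
          * (t / A powr p * \<bar>u x\<bar> powr p + (1 - t) / B powr p * \<bar>v x\<bar> powr p)) * \<mu> x"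
        using \<mu>[of x] by (intro mult_right_mono) auto
      then show ?thesis by (simp add: algebra_simps)
    qed
    have "(\<Sum>x\<in>F. \<bar>u x + v x\<bar> powr p * \<mu> x) \<le> (\<Sum>x\<in>F. (A + B) powr p *
          (t / A powr p * (\<bar>u x\<bar> powr p * \<mu> x) + (1 - t) / B powr p * (\<bar>v x\<bar> powr p * \<mu> x)))"
      by (intro sum_mono pt)
    also have "\<dots> = (A + B) powr p * (t / A powr p * (\<Sum>x\<in>F. \<bar>u x\<bar> powr p * \<mu> x)
        + (1 - t) / B powr p * (\<Sum>x\<in>F. \<bar>v x\<bar> powr p * \<mu> x))"
      by (simp add: sum_distrib_left sum.distrib algebra_simps)
    also have "\<dots> \<le> (A + B) powr p * (t / A powr p * A powr p + (1 - t) / B powr p * B powr p)"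
      using U V t A0 B0 by (intro mult_left_mono add_mono) auto
    also have "\<dots> = (A + B) powr p" using A0 B0 by simp
    finally show ?thesis .
  qed
  then show ?thesis
    using lp_bound_iff_finite_sums[where \<mu> = \<mu>, OF p \<mu>, of "A + B" "\<lambda>x. u x + v x"] A0 B0 by auto
qed

lemma lp_space_add:
  assumes "1 \<le> p" "\<And>x. 0 < \<mu> x" "u \<in> lp_space p \<mu>" "v \<in> lp_space p \<mu>"
  shows "(\<lambda>x. u x + v x) \<in> lp_space p \<mu>"
  using lp_bound_add[where \<mu> = \<mu>, OF assms, of "lp_norm p \<mu> u + 1" "lp_norm p \<mu> v + 1"] by simp

lemma lp_norm_triangle:
  assumes "1 \<le> p" "\<And>x. 0 < \<mu> x" "u \<in> lp_space p \<mu>" "v \<in> lp_space p \<mu>"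
  shows "lp_norm p \<mu> (\<lambda>x. u x + v x) \<le> lp_norm p \<mu> u + lp_norm p \<mu> v"
proof (rule field_le_epsilon)
  fix e :: real assume "0 < e"
  then show "lp_norm p \<mu> (\<lambda>x. u x + v x) \<le> lp_norm p \<mu> u + lp_norm p \<mu> v + e"
    using lp_bound_add[where \<mu> = \<mu>, OF assms, of "lp_norm p \<mu> u + e / 2" "lp_norm p \<mu> v + e / 2"] by simp
qed

lemma lp_space_cmult:
  assumes "u \<in> lp_space p \<mu>"
  shows "(\<lambda>x. c * u x) \<in> lp_space p \<mu>"
proof -
  have "(\<lambda>x. \<bar>c\<bar> powr p * (\<bar>u x\<bar> powr p * \<mu> x)) summable_on UNIV"
    using assms by (intro summable_on_cmult_right) (simp add: lp_space_def)
  then show ?thesis by (simp add: lp_space_def abs_mult powr_mult mult.assoc)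
qed

lemma lp_norm_cmult:
  assumes "1 \<le> p" "\<And>x. 0 < \<mu> x"
  shows "lp_norm p \<mu> (\<lambda>x. c * u x) = \<bar>c\<bar> * lp_norm p \<mu> u"
proof -
  have "lp_norm p \<mu> (\<lambda>x. c * u x) = (\<Sum>\<^sub>\<infinity>x. \<bar>c\<bar> powr p * (\<bar>u x\<bar> powr p * \<mu> x)) powr (1 / p)"
    by (simp add: lp_norm_def abs_mult powr_mult mult.assoc)
  also have "\<dots> = (\<bar>c\<bar> powr p * (\<Sum>\<^sub>\<infinity>x. \<bar>u x\<bar> powr p * \<mu> x)) powr (1 / p)"
    by (simp add: infsum_cmult_right')
  also have "\<dots> = (\<bar>c\<bar> powr p) powr (1 / p) * lp_norm p \<mu> u"
    unfolding lp_norm_def by (rule powr_mult)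
  finally show ?thesis using assms by (simp add: powr_powr)
qed

lemma lp_norm_minus_commute: "lp_norm p \<mu> (\<lambda>x. u x - v x) = lp_norm p \<mu> (\<lambda>x. v x - u x)"
  by (simp add: lp_norm_def abs_minus_commute)

lemma lp_space_diff:
  assumes "1 \<le> p" "\<And>x. 0 < \<mu> x" "u \<in> lp_space p \<mu>" "v \<in> lp_space p \<mu>"
  shows "(\<lambda>x. u x - v x) \<in> lp_space p \<mu>"
  using lp_space_add[where \<mu> = \<mu>, OF assms(1,2,3) lp_space_cmult[OF assms(4), of "-1"]] by simp

lemma lp_norm_triangle_diff:
  assumes p: "1 \<le> p" and \<mu>: "\<And>x. 0 < \<mu> x"
    and "u \<in> lp_space p \<mu>" "v \<in> lp_space p \<mu>" "z \<in> lp_space p \<mu>"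
  shows "lp_norm p \<mu> (\<lambda>x. u x - z x) \<le> lp_norm p \<mu> (\<lambda>x. u x - v x) + lp_norm p \<mu> (\<lambda>x. v x - z x)"
  using lp_norm_triangle[where \<mu> = \<mu>, OF p \<mu> lp_space_diff[where \<mu> = \<mu>, OF p \<mu> assms(3,4)] lp_space_diff[where \<mu> = \<mu>, OF p \<mu> assms(4,5)]]
  by simp

lemma abs_le_lp_norm:
  assumes p: "1 \<le> p" and \<mu>: "\<And>x. 0 < \<mu> x" and u: "u \<in> lp_space p \<mu>"
  shows "\<bar>u x\<bar> * \<mu> x powr (1 / p) \<le> lp_norm p \<mu> u"
proof -
  have "\<bar>u x\<bar> powr p * \<mu> x \<le> lp_norm p \<mu> u powr p"
    using lp_bound_iff_finite_sums[where \<mu> = \<mu>, OF p \<mu>, of "lp_norm p \<mu> u" u, THEN iffD1, rule_format, of "{x}"] u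
    by simp
  then have "(\<bar>u x\<bar> powr p * \<mu> x) powr (1 / p) \<le> (lp_norm p \<mu> u powr p) powr (1 / p)"
    using p \<mu>[of x] by (intro powr_mono2) auto
  then show ?thesis
    using p \<mu>[of x] by (simp add: powr_mult powr_powr)
qed

lemma lp_norm_powr:
  assumes "1 \<le> p" "\<And>x. 0 < \<mu> x"
  shows "lp_norm p \<mu> u powr p = (\<Sum>\<^sub>\<infinity>x. \<bar>u x\<bar> powr p * \<mu> x)"
proof -
  have "0 \<le> (\<Sum>\<^sub>\<infinity>x. \<bar>u x\<bar> powr p * \<mu> x)"
    using assms(2) less_imp_le by (intro infsum_nonneg) (auto intro!: mult_nonneg_nonneg)
  then show ?thesis using assms by (simp add: lp_norm_def powr_powr)
qed

text \<open>Scheffe's argument. On a finite set carrying almost all of \<open>f\<close>, the function \<open>z n\<close> eventually has almost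
  as much mass as \<open>f\<close>; having no more than \<open>f\<close> in total, it has little outside.\<close>

lemma lp_tendsto_if_pointwise_and_norm_le:
  fixes z :: "nat \<Rightarrow> 'a::countable \<Rightarrow> real"
  assumes p: "1 \<le> p" and \<mu>: "\<And>x. 0 < \<mu> x"
    and f: "f \<in> lp_space p \<mu>" "\<And>x. 0 \<le> f x"
    and z: "\<And>n. z n \<in> lp_space p \<mu>" "\<And>n x. 0 \<le> z n x"
    and le: "\<And>n. lp_norm p \<mu> (z n) \<le> lp_norm p \<mu> f"
    and lim: "\<And>x. (\<lambda>n. z n x) \<longlonglongrightarrow> f x"
  shows "(\<lambda>n. lp_norm p \<mu> (\<lambda>x. z n x - f x)) \<longlonglongrightarrow> 0"
proof (rule LIMSEQ_I)
  fix e :: real assume e: "0 < e"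
  \<comment> \<open>The far part contributes \<open>2 d\<close> from \<open>z n\<close> and \<open>d\<close> from \<open>f\<close>, the finite part another \<open>d\<close>.\<close>
  define d where "d = (e / 2) powr p / 4"
  have d: "0 < d" using e by (simp add: d_def)
  let ?f = "\<lambda>x. f x powr p * \<mu> x"
  let ?z = "\<lambda>n x. z n x powr p * \<mu> x"
  have fs: "?f summable_on UNIV" using f by (simp add: lp_space_def)
  have zs: "?z n summable_on UNIV" for n using z by (simp add: lp_space_def)
  have leI: "infsum (?z n) UNIV \<le> infsum ?f UNIV" for n
  proof -
    have "lp_norm p \<mu> (z n) powr p \<le> lp_norm p \<mu> f powr p"
      using le[of n] p by (intro powr_mono2) auto
    then show ?thesis using f z by (simp add: lp_norm_powr[where \<mu> = \<mu>, OF p \<mu>])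
  qed
  obtain F where F: "finite F" "infsum ?f UNIV - d \<le> sum ?f F"
    using infsum_finite_approximation[OF fs d] by (auto simp: dist_real_def abs_le_iff)
  have "(\<lambda>n. sum (?z n) F) \<longlonglongrightarrow> sum ?f F"
    using p z by (intro tendsto_intros lim tendsto_powr2) auto
  then have ev1: "\<forall>\<^sub>F n in sequentially. sum ?f F - d < sum (?z n) F"
    using d by (intro order_tendstoD) auto
  have "(\<lambda>n. \<Sum>x\<in>F. \<bar>z n x - f x\<bar> powr p * \<mu> x) \<longlonglongrightarrow> (\<Sum>x\<in>F. \<bar>f x - f x\<bar> powr p * \<mu> x)"
    using p by (intro tendsto_intros lim tendsto_powr2) auto
  then have ev2: "\<forall>\<^sub>F n in sequentially. (\<Sum>x\<in>F. \<bar>z n x - f x\<bar> powr p * \<mu> x) < d"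
    using d p by (intro order_tendstoD) auto
  have "\<forall>\<^sub>F n in sequentially. lp_norm p \<mu> (\<lambda>x. z n x - f x) < e"
    using ev1 ev2
  proof eventually_elim
    case (elim n)
    have "(\<Sum>x\<in>H. \<bar>z n x - f x\<bar> powr p * \<mu> x) \<le> (e / 2) powr p" if H: "finite H" for H
    proof -
      have pos: "0 \<le> \<bar>z n x - f x\<bar> powr p * \<mu> x" for x using \<mu>[of x] by simp
      have ptw: "\<bar>z n x - f x\<bar> powr p * \<mu> x \<le> ?z n x + ?f x" for x
      proof -
        have "\<bar>z n x - f x\<bar> powr p \<le> max (z n x) (f x) powr p"
          using z(2)[of n x] f(2)[of x] p by (intro powr_mono2) auto
        also have "\<dots> \<le> z n x powr p + f x powr p" by (simp add: max_def)
        finally show ?thesis using \<mu>[of x] by (simp add: distrib_right[symmetric])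
      qed
      have "(\<Sum>x\<in>H. \<bar>z n x - f x\<bar> powr p * \<mu> x) \<le> (\<Sum>x\<in>H \<union> F. \<bar>z n x - f x\<bar> powr p * \<mu> x)"
        using H F pos by (intro sum_mono2) auto
      also have "H \<union> F = F \<union> (H - F)" by blast
      also have "(\<Sum>x\<in>F \<union> (H - F). \<bar>z n x - f x\<bar> powr p * \<mu> x)
          = (\<Sum>x\<in>F. \<bar>z n x - f x\<bar> powr p * \<mu> x)
          + (\<Sum>x\<in>H - F. \<bar>z n x - f x\<bar> powr p * \<mu> x)"
        using H F by (intro sum.union_disjoint) auto
      finally have split: "(\<Sum>x\<in>H. \<bar>z n x - f x\<bar> powr p * \<mu> x)
          \<le> (\<Sum>x\<in>F. \<bar>z n x - f x\<bar> powr p * \<mu> x)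
          + (\<Sum>x\<in>H - F. \<bar>z n x - f x\<bar> powr p * \<mu> x)" .
      have "(\<Sum>x\<in>H - F. \<bar>z n x - f x\<bar> powr p * \<mu> x) \<le> (\<Sum>x\<in>H - F. ?z n x + ?f x)"
        by (intro sum_mono ptw)
      then have tail: "(\<Sum>x\<in>H - F. \<bar>z n x - f x\<bar> powr p * \<mu> x)
          \<le> sum (?z n) (H - F) + sum ?f (H - F)" by (simp add: sum.distrib)
      have "sum (?z n) F + sum (?z n) (H - F) \<le> infsum (?z n) UNIV"
      proof -
        have "sum (?z n) (F \<union> (H - F)) \<le> infsum (?z n) UNIV"
          using H F zs \<mu> less_imp_le by (intro finite_sum_le_infsum) (auto intro!: mult_nonneg_nonneg)
        then show ?thesis using H F by (subst (asm) sum.union_disjoint) auto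
      qed
      then have "sum (?z n) (H - F) \<le> 2 * d" using leI[of n] F(2) elim(1) by linarith
      moreover have "sum ?f (H - F) \<le> d"
      proof -
        have "sum ?f (F \<union> (H - F)) \<le> infsum ?f UNIV"
          using H F fs \<mu> less_imp_le by (intro finite_sum_le_infsum) (auto intro!: mult_nonneg_nonneg)
        then show ?thesis using H F by (subst (asm) sum.union_disjoint) auto
      qed
      ultimately have "(\<Sum>x\<in>H. \<bar>z n x - f x\<bar> powr p * \<mu> x) \<le> 4 * d"
        using elim(2) split tail by linarith
      also have "\<dots> \<le> (e / 2) powr p" by (simp add: d_def)
      finally show ?thesis .
    qed
    then have "lp_norm p \<mu> (\<lambda>x. z n x - f x) \<le> e / 2"
      using lp_bound_iff_finite_sums[where \<mu> = \<mu>, OF p \<mu>, of "e / 2" "\<lambda>x. z n x - f x"] e by auto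
    then show ?case using e by linarith
  qed
  then show "\<exists>N. \<forall>n\<ge>N. norm (lp_norm p \<mu> (\<lambda>x. z n x - f x) - 0) < e"
    by (simp add: eventually_sequentially)
qed

section \<open>Uniform grids and double sequences\<close>

text \<open>The recursion puts \<open>a (Suc i) (Suc j)\<close> below a weighted mean of two predecessors, with
  weights \<open>r / (l + r)\<close> and \<open>l / (l + r)\<close>. The quadratic \<open>(i l - j r)\<^sup>2 + i l\<^sup>2 + j r\<^sup>2\<close> reproduces itself
  exactly under this mean (it is a martingale of the random walk on index pairs that the recursion
  describes), hence so does every affine function of it. On the two axes \<open>x \<le> \<eta> + x\<^sup>2 / \<eta>\<close> turns the
  linear bound into a quadratic one. Optimising in \<open>\<eta>\<close> yields the classical square-root estimate.\<close>

lemma double_sequence_bound: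
  fixes a :: "nat \<Rightarrow> nat \<Rightarrow> real"
  assumes pos: "0 < l" "0 < r" "0 < \<eta>" and C: "0 \<le> C"
    and left: "\<And>i. a i 0 \<le> d + C * (real i * l)"
    and right: "\<And>j. a 0 j \<le> d + C * (real j * r)"
    and step: "\<And>i j. (l + r) * a (Suc i) (Suc j) \<le> r * a i (Suc j) + l * a (Suc i) j"
  shows "a i j \<le> d + C * (\<eta> + ((real i * l - real j * r)\<^sup>2 + real i * l\<^sup>2 + real j * r\<^sup>2) / \<eta>)"
proof -
  define b where "b i j = d + C * (\<eta> + ((real i * l - real j * r)\<^sup>2 + real i * l\<^sup>2 + real j * r\<^sup>2) / \<eta>)"
    for i j
  have bdry: "d + C * x \<le> d + C * (\<eta> + (x\<^sup>2 + y) / \<eta>)" if "0 \<le> x" "0 \<le> y" for x y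
  proof -
    have "x * \<eta> \<le> \<eta>\<^sup>2 + x\<^sup>2"
      using sum_squares_bound[of x \<eta>] mult_nonneg_nonneg[of x \<eta>] that pos by linarith
    then have "x \<le> \<eta> + x\<^sup>2 / \<eta>" using pos by (simp add: field_simps power2_eq_square)
    also have "\<dots> \<le> \<eta> + (x\<^sup>2 + y) / \<eta>" using that pos by (simp add: divide_right_mono)
    finally show ?thesis using C by (simp add: mult_left_mono)
  qed
  have rec: "(l + r) * b (Suc i) (Suc j) = r * b i (Suc j) + l * b (Suc i) j" for i j
    unfolding b_def using pos by (simp add: field_simps power2_eq_square) 
  have "a i j \<le> b i j"
  proof (induction "i + j" arbitrary: i j rule: less_induct)
    case less
    consider "i = 0" | "j = 0" | i' j' where "i = Suc i'" "j = Suc j'"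
      by (meson not0_implies_Suc)
    then show ?case
    proof cases
      case 1
      then show ?thesis using right[of j] bdry[of "real j * r" "real j * r\<^sup>2"] pos
        by (simp add: b_def)
    next
      case 2
      then show ?thesis using left[of i] bdry[of "real i * l" "real i * l\<^sup>2"] pos
        by (simp add: b_def)
    next
      case 3
      have "a i' (Suc j') \<le> b i' (Suc j')" "a (Suc i') j' \<le> b (Suc i') j'"
        using less[of i' "Suc j'"] less[of "Suc i'" j'] 3 by auto
      then have "r * a i' (Suc j') + l * a (Suc i') j' \<le> r * b i' (Suc j') + l * b (Suc i') j'"
        using pos by (intro add_mono mult_left_mono) auto
      then have "(l + r) * a (Suc i') (Suc j') \<le> (l + r) * b (Suc i') (Suc j')"
        using step[of i' j'] rec[of i' j'] by linarith
      then show ?thesis using pos 3 by simp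
    qed
  qed
  then show ?thesis by (simp add: b_def)
qed

lemma one_plus_power_le_exp:
  fixes a :: real assumes "0 \<le> a" shows "(1 + a) ^ k \<le> exp (a * real k)"
proof -
  have "(1 + a) ^ k \<le> exp a ^ k" using assms exp_ge_add_one_self[of a] by (intro power_mono) auto
  then show ?thesis by (simp add: exp_of_nat_mult[symmetric] mult.commute)
qed

text \<open>The index \<open>k\<close> with \<open>t\<close> in the half-open interval \<open>((k - 1) l, k l]\<close>, matching the convention that a
  step function takes its value from the right end.\<close>

definition grid_index :: "real \<Rightarrow> real \<Rightarrow> nat" where
  "grid_index l t = nat \<lceil>t / l\<rceil>"

lemma grid_index_bounds:
  assumes "0 < l" "0 \<le> t"
  shows "t \<le> real (grid_index l t) * l" "real (grid_index l t) * l < t + l"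
proof -
  have "0 \<le> t / l" using assms by simp
  then have "0 \<le> \<lceil>t / l\<rceil>" by linarith
  then have e: "real (grid_index l t) = of_int \<lceil>t / l\<rceil>" by (simp add: grid_index_def)
  have "t / l \<le> of_int \<lceil>t / l\<rceil>" "of_int \<lceil>t / l\<rceil> < t / l + 1"
    by linarith+
  then show "t \<le> real (grid_index l t) * l" "real (grid_index l t) * l < t + l"
    unfolding e using assms by (simp_all only: pos_divide_le_eq pos_le_divide_eq) (simp add: field_simps)
qed

lemma grid_index_eq:
  assumes l: "0 < l" and k: "1 \<le> k" and s: "real (k - 1) * l < s" "s \<le> real k * l"
  shows "grid_index l s = k"
proof -
  have "\<lceil>s / l\<rceil> = int k"
  proof (rule ceiling_unique)
    show "real_of_int (int k) - 1 < s / l" using s(1) l k by (simp add: field_simps of_nat_diff)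
    show "s / l \<le> real_of_int (int k)" using s(2) l by (simp add: field_simps)
  qed
  then show ?thesis by (simp add: grid_index_def)
qed

lemma grid_index_mono: "0 < l \<Longrightarrow> s \<le> t \<Longrightarrow> grid_index l s \<le> grid_index l t"
  unfolding grid_index_def by (intro nat_mono ceiling_mono divide_right_mono) auto

definition mesh :: "nat \<Rightarrow> real" where
  "mesh n = inverse (real (Suc n))"

lemma mesh_pos: "0 < mesh n" and mesh_lim: "mesh \<longlonglongrightarrow> 0"
  using LIMSEQ_inverse_real_of_nat by (auto simp: mesh_def[abs_def])

lemma eventually_mesh_le: "0 < \<rho> \<Longrightarrow> \<forall>\<^sub>F n in sequentially. mesh n \<le> \<rho>"
  using order_tendstoD(2)[OF mesh_lim, of \<rho>] by (auto elim: eventually_mono)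

lemma grid_time_tendsto:
  assumes "0 \<le> t"
  shows "(\<lambda>n. real (grid_index (mesh n) t) * mesh n) \<longlonglongrightarrow> t"
proof (rule tendsto_sandwich)
  show "\<forall>\<^sub>F n in sequentially. t \<le> real (grid_index (mesh n) t) * mesh n"
    using grid_index_bounds[OF mesh_pos assms] by simp
  show "\<forall>\<^sub>F n in sequentially. real (grid_index (mesh n) t) * mesh n \<le> t + mesh n"
    using grid_index_bounds[OF mesh_pos assms] by (simp add: less_imp_le)
  show "(\<lambda>n. t + mesh n) \<longlonglongrightarrow> t"
    using tendsto_add[OF tendsto_const mesh_lim, of t] by simp
qed simp

section \<open>The scalar absorption equation\<close>

locale absorption =
  fixes q :: real
  assumes q_pos: "0 < q"
begin

text \<open>The absorption term is increasing, so it can only push two states apart further in the image.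
  Dropping it gives the Lipschitz bound of the scalar resolvent, whatever \<open>q\<close> is.\<close>

lemma absorption_diff:
  assumes "0 \<le> \<alpha>" "0 \<le> l" "0 \<le> s" "0 \<le> t"
  shows "\<alpha> * \<bar>s - t\<bar> \<le> \<bar>(\<alpha> * s + l * s powr q) - (\<alpha> * t + l * t powr q)\<bar>"
proof -
  have *: "\<alpha> * (b - a) \<le> (\<alpha> * b + l * b powr q) - (\<alpha> * a + l * a powr q)" if "0 \<le> a" "a \<le> b" for a b
  proof -
    have "l * a powr q \<le> l * b powr q"
      using that assms q_pos by (intro mult_left_mono powr_mono2) auto
    then show ?thesis by (simp add: algebra_simps)
  qed
  show ?thesis
    using *[of s t] *[of t s] assms by (cases "s \<le> t") auto
qed

lemma absorption_cancel:
  assumes "0 < \<alpha>" "0 \<le> l" "0 \<le> s" "0 \<le> t" "\<alpha> * s + l * s powr q \<le> \<alpha> * t + l * t powr q"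
  shows "s \<le> t"
proof (rule ccontr)
  assume "\<not> s \<le> t"
  then have "l * t powr q \<le> l * s powr q" "\<alpha> * t < \<alpha> * s"
    using assms q_pos by (auto intro!: mult_left_mono powr_mono2)
  then show False using assms by linarith
qed

definition scalar_res :: "real \<Rightarrow> real \<Rightarrow> real \<Rightarrow> real" where
  "scalar_res \<alpha> l b = (THE s. 0 \<le> s \<and> \<alpha> * s + l * s powr q = b)"

lemma scalar_res:
  assumes "0 < \<alpha>" "0 \<le> l" "0 \<le> b"
  shows "0 \<le> scalar_res \<alpha> l b"
    and "\<alpha> * scalar_res \<alpha> l b + l * scalar_res \<alpha> l b powr q = b"
proof -
  have "\<exists>s\<ge>0. s \<le> b / \<alpha> \<and> \<alpha> * s + l * s powr q = b"
  proof (rule IVT')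
    show "\<alpha> * 0 + l * 0 powr q \<le> b" using assms by simp
    show "b \<le> \<alpha> * (b / \<alpha>) + l * (b / \<alpha>) powr q" "0 \<le> b / \<alpha>" using assms by auto
    show "continuous_on {0..b / \<alpha>} (\<lambda>s. \<alpha> * s + l * s powr q)"
      using q_pos by (intro continuous_intros continuous_on_powr') auto
  qed
  then obtain s where s: "0 \<le> s \<and> \<alpha> * s + l * s powr q = b" by blast
  have "0 \<le> scalar_res \<alpha> l b \<and> \<alpha> * scalar_res \<alpha> l b + l * scalar_res \<alpha> l b powr q = b"
    unfolding scalar_res_def
  proof (rule theI[of _ s])
    show "t = s" if "0 \<le> t \<and> \<alpha> * t + l * t powr q = b" for t
      using absorption_cancel[OF assms(1,2), of s t] absorption_cancel[OF assms(1,2), of t s] s that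
      by (simp add: order_antisym)
  qed (rule s)
  then show "0 \<le> scalar_res \<alpha> l b" "\<alpha> * scalar_res \<alpha> l b + l * scalar_res \<alpha> l b powr q = b"
    by auto
qed

text \<open>A primitive of \<open>s powr (- q)\<close>. Along \<open>y' = - y powr q\<close> it decreases at unit speed, so solving for
  \<open>y\<close> yields both bounds of the theorem; working with the clock treats \<open>q < 1\<close> and \<open>q > 1\<close> at once.\<close>

definition absorption_clock :: "real \<Rightarrow> real" where
  "absorption_clock s = s powr (1 - q) / (1 - q)"

lemma absorption_clock_drop:
  assumes q1: "q \<noteq> 1" and ab: "0 < a" "a \<le> b"
  shows "(b - a) * b powr (- q) \<le> absorption_clock b - absorption_clock a"
proof (cases "a = b")
  case False
  have "\<exists>z. a < z \<and> z < b \<and> absorption_clock b - absorption_clock a = (b - a) * z powr (- q)"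
  proof (rule MVT2)
    show "a < b" using ab False by simp
    fix x assume x: "a \<le> x" "x \<le> b"
    then have "((\<lambda>s. s powr (1 - q) / (1 - q)) has_real_derivative (1 - q) * x powr (1 - q - 1) / (1 - q)) (at x)"
      using ab by (auto intro!: derivative_eq_intros)
    then show "(absorption_clock has_real_derivative x powr (- q)) (at x)"
      unfolding absorption_clock_def[abs_def] using q1 by simp
  qed
  then obtain z where z: "a < z" "z < b" "absorption_clock b - absorption_clock a = (b - a) * z powr (- q)"
    by blast
  have "b powr (- q) \<le> z powr (- q)"
    using z ab q_pos by (intro powr_mono2') auto
  then show ?thesis unfolding z(3) using ab by (intro mult_left_mono) auto
qed simp

lemma absorption_clock_mono:
  assumes "q \<noteq> 1" "0 < a" "a \<le> b"
  shows "absorption_clock a \<le> absorption_clock b"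
proof -
  have "0 \<le> (b - a) * b powr (- q)" using assms by simp
  then show ?thesis using absorption_clock_drop[OF assms] by linarith
qed

primrec scalar_euler :: "real \<Rightarrow> real \<Rightarrow> nat \<Rightarrow> real" where
  "scalar_euler l c 0 = c"
| "scalar_euler l c (Suc k) = scalar_res 1 l (scalar_euler l c k)"

lemma scalar_euler_facts:
  assumes l: "0 < l" and c: "0 \<le> c"
  shows "0 \<le> scalar_euler l c k"
    and "scalar_euler l c (Suc k) + l * scalar_euler l c (Suc k) powr q = scalar_euler l c k"
    and "scalar_euler l c (Suc k) \<le> scalar_euler l c k"
    and "scalar_euler l c k \<le> c"
proof -
  show nn: "0 \<le> scalar_euler l c k" for k
    by (induction k) (use l c in \<open>auto intro: scalar_res\<close>)
  show eq: "scalar_euler l c (Suc k) + l * scalar_euler l c (Suc k) powr q = scalar_euler l c k" for k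
    using scalar_res(2)[of 1 l "scalar_euler l c k"] nn[of k] l by simp
  show dec: "scalar_euler l c (Suc k) \<le> scalar_euler l c k" for k
  proof -
    have "0 \<le> l * scalar_euler l c (Suc k) powr q" using l by simp
    then show ?thesis using eq[of k] by linarith
  qed
  show "scalar_euler l c k \<le> c"
  proof (induction k)
    case (Suc k)
    then show ?case using dec[of k] by linarith
  qed simp
qed

text \<open>One implicit Euler step lets the clock run by at least \<open>l (a / b) powr q\<close>, where \<open>b\<close> and \<open>a\<close> are the
  values before and after the step, and \<open>b / a = 1 + l a powr (q - 1)\<close>. This ratio tends to one as \<open>l\<close>
  tends to zero, as long as \<open>a powr (q - 1)\<close> stays bounded. For \<open>q < 1\<close> that fails at extinction, hence the
  threshold \<open>\<eta>\<close>.\<close>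

lemma scalar_euler_clock:
  assumes q1: "q \<noteq> 1" and l: "0 < l" and c: "0 \<le> c" and \<eta>: "0 < \<eta>"
    and B: "B = max (\<eta> powr (q - 1)) (c powr (q - 1))"
    and ge: "\<eta> \<le> scalar_euler l c k"
  shows "absorption_clock (scalar_euler l c k) \<le> absorption_clock c - (real k * l) * (1 + l * B) powr (- q)"
  using ge
proof (induction k)
  case 0
  then show ?case by simp
next
  case (Suc k)
  note f = scalar_euler_facts[OF l c]
  let ?b = "scalar_euler l c k" and ?a = "scalar_euler l c (Suc k)"
  have \<eta>b: "\<eta> \<le> ?b" using Suc.prems f(3)[of k] by linarith
  have a: "0 < ?a" "?a \<le> c" using Suc.prems \<eta> f(4)[of "Suc k"] by linarith+
  have b: "0 < ?b" using \<eta>b \<eta> by linarith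
  have aB: "?a powr (q - 1) \<le> B"
  proof (cases "1 \<le> q")
    case True
    then have "?a powr (q - 1) \<le> c powr (q - 1)" using a by (intro powr_mono2) auto
    then show ?thesis by (simp add: B)
  next
    case False
    then have "?a powr (q - 1) \<le> \<eta> powr (q - 1)" using Suc.prems \<eta> by (intro powr_mono2') auto
    then show ?thesis by (simp add: B)
  qed
  have "?b = ?a * (1 + l * ?a powr (q - 1))"
    using f(2)[of k] a powr_mult_base[of ?a "q - 1"] by (simp add: algebra_simps)
  also have "\<dots> \<le> ?a * (1 + l * B)"
    using aB a l by (intro mult_left_mono add_left_mono) auto
  finally have ba: "?b \<le> ?a * (1 + l * B)" .
  have B0: "0 \<le> B" by (simp add: B le_max_iff_disj)
  then have lB: "0 < 1 + l * B" using l by (simp add: add_pos_nonneg)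
  have "l * (1 + l * B) powr (- q) = l * ?a powr q * (?a * (1 + l * B)) powr (- q)"
    using a by (simp only: powr_mult) (simp add: powr_minus del: scalar_euler.simps)
  also have "\<dots> \<le> l * ?a powr q * ?b powr (- q)"
    using ba a b l q_pos by (intro mult_left_mono powr_mono2') auto
  also have "\<dots> = (?b - ?a) * ?b powr (- q)"
  proof -
    have "?b - ?a = l * ?a powr q" using f(2)[of k] by linarith
    then show ?thesis by simp
  qed
  also have "\<dots> \<le> absorption_clock ?b - absorption_clock ?a"
    using f(3)[of k] a by (intro absorption_clock_drop[OF q1]) auto
  finally show ?case using Suc.IH[OF \<eta>b] by (simp add: algebra_simps)
qed

end

section \<open>The Laplacian on bounded functions\<close>

locale absorption_graph = absorption +
  fixes w :: "'a::countable \<Rightarrow> 'a \<Rightarrow> real" and \<kappa> \<mu> :: "'a \<Rightarrow> real"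
  assumes graph: "weighted_graph w \<kappa> \<mu>"
begin

lemma w_nonneg: "0 \<le> w x y" and w_sym: "w x y = w y x" and w_summable: "w x summable_on UNIV"
  and \<kappa>_nonneg: "0 \<le> \<kappa> x" and \<mu>_pos: "0 < \<mu> x"
  using graph by (auto simp: weighted_graph_def)

definition deg :: "'a \<Rightarrow> real" where
  "deg x = (\<Sum>\<^sub>\<infinity>y. w x y)"

text \<open>The diagonal coefficient of the Laplacian. For bounded functions \<open>\<Delta> u = rate * u - nbr u\<close>, where \<open>nbr\<close>
  is the off-diagonal part.\<close>

definition rate :: "'a \<Rightarrow> real" where
  "rate x = (deg x + \<kappa> x) / \<mu> x"

definition nbr :: "('a \<Rightarrow> real) \<Rightarrow> 'a \<Rightarrow> real" where
  "nbr u x = (\<Sum>\<^sub>\<infinity>y. w x y * u y) / \<mu> x"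

lemma deg_nonneg: "0 \<le> deg x"
  unfolding deg_def by (intro infsum_nonneg w_nonneg)

lemma rate_nonneg: "0 \<le> rate x"
  unfolding rate_def using deg_nonneg[of x] \<kappa>_nonneg[of x] \<mu>_pos[of x] by simp

lemma summable_w_bounded:
  assumes "\<And>y. \<bar>u y\<bar> \<le> C"
  shows "(\<lambda>y. w x y * u y) summable_on UNIV"
proof (rule abs_summable_summable)
  show "(\<lambda>y. norm (w x y * u y)) summable_on UNIV"
  proof (rule summable_on_comparison_test)
    show "(\<lambda>y. w x y * C) summable_on UNIV"
      by (intro summable_on_cmult_left w_summable)
  qed (use assms w_nonneg in \<open>auto simp: abs_mult intro!: mult_left_mono\<close>)
qed

lemma nbr_nonneg: "(\<And>y. 0 \<le> u y) \<Longrightarrow> 0 \<le> nbr u x"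
  unfolding nbr_def using \<mu>_pos[of x] w_nonneg by (auto intro!: divide_nonneg_pos infsum_nonneg)

lemma nbr_mono:
  assumes "\<And>y. \<bar>u y\<bar> \<le> C" "\<And>y. \<bar>v y\<bar> \<le> C'" "\<And>y. u y \<le> v y"
  shows "nbr u x \<le> nbr v x"
  unfolding nbr_def using \<mu>_pos[of x] assms w_nonneg summable_w_bounded[of u C x]
    summable_w_bounded[of v C' x]
  by (auto intro!: divide_right_mono infsum_mono mult_left_mono)

lemma nbr_add:
  assumes "\<And>y. \<bar>u y\<bar> \<le> C" "\<And>y. \<bar>v y\<bar> \<le> C'"
  shows "nbr (\<lambda>y. u y + v y) x = nbr u x + nbr v x"
  unfolding nbr_def using summable_w_bounded[of u C x] summable_w_bounded[of v C' x] assms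
  by (simp add: distrib_left infsum_add add_divide_distrib)

lemma nbr_cmult: "nbr (\<lambda>y. c * u y) x = c * nbr u x"
proof -
  have "(\<Sum>\<^sub>\<infinity>y. w x y * (c * u y)) = (\<Sum>\<^sub>\<infinity>y. c * (w x y * u y))"
    by (simp add: mult.left_commute)
  then show ?thesis by (simp add: nbr_def infsum_cmult_right')
qed

lemma nbr_diff:
  assumes "\<And>y. \<bar>u y\<bar> \<le> C" "\<And>y. \<bar>v y\<bar> \<le> C'"
  shows "nbr (\<lambda>y. u y - v y) x = nbr u x - nbr v x"
  using nbr_add[of u C "\<lambda>y. - 1 * v y" C'] assms unfolding nbr_cmult by simp

lemma nbr_const: "nbr (\<lambda>y. c) x = c * (deg x / \<mu> x)"
  by (simp add: nbr_def deg_def infsum_cmult_left')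

lemma deg_le_rate: "deg x / \<mu> x \<le> rate x"
  unfolding rate_def using \<kappa>_nonneg[of x] \<mu>_pos[of x] by (simp add: divide_right_mono)

lemma nbr_le_rate:
  assumes "\<And>y. 0 \<le> u y" "\<And>y. u y \<le> C"
  shows "nbr u x \<le> C * rate x"
proof -
  have C: "0 \<le> C" using assms[of x] by linarith
  have "nbr u x \<le> nbr (\<lambda>y. C) x"
    using assms C by (intro nbr_mono[of _ C _ C]) (auto simp: abs_le_iff intro: order_trans)
  also have "\<dots> \<le> C * rate x"
    unfolding nbr_const using C deg_le_rate by (intro mult_left_mono)
  finally show ?thesis .
qed

lemma abs_nbr_le:
  assumes "\<And>y. \<bar>u y\<bar> \<le> C"
  shows "\<bar>nbr u x\<bar> \<le> nbr (\<lambda>y. \<bar>u y\<bar>) x"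
proof -
  have "nbr u x \<le> nbr (\<lambda>y. \<bar>u y\<bar>) x" using assms by (intro nbr_mono[of _ C _ C]) auto
  moreover have "nbr (\<lambda>y. -1 * u y) x \<le> nbr (\<lambda>y. \<bar>u y\<bar>) x"
    using assms by (intro nbr_mono[of _ C _ C]) auto
  ultimately show ?thesis unfolding nbr_cmult by linarith
qed

lemma nbr_ge_single:
  assumes "\<And>y. 0 \<le> u y" "\<And>y. u y \<le> C"
  shows "w x y / \<mu> x * u y \<le> nbr u x"
proof -
  have "(\<Sum>z\<in>{y}. w x z * u z) \<le> (\<Sum>\<^sub>\<infinity>z. w x z * u z)"
    using assms w_nonneg by (intro finite_sum_le_infsum summable_w_bounded[of _ C]) auto
  then show ?thesis using \<mu>_pos[of x] by (simp add: nbr_def divide_right_mono)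
qed

text \<open>Tonelli and the symmetry of \<open>w\<close>: mass sent out by the nodes equals mass received.\<close>

lemma nbr_total:
  assumes u: "\<And>y. 0 \<le> u y" "\<And>y. u y \<le> C" and s: "(\<lambda>y. deg y * u y) summable_on UNIV"
  shows "((\<lambda>x. \<mu> x * nbr u x) has_sum (\<Sum>\<^sub>\<infinity>y. deg y * u y)) UNIV"
proof -
  have col: "((\<lambda>x. w x y * u y) has_sum (deg y * u y)) UNIV" for y
    using has_sum_cmult_left[OF has_sum_infsum[OF w_summable[of y]], of "u y"]
    by (simp add: deg_def w_sym[of _ y])
  have "(\<lambda>(y, x). w x y * u y) summable_on UNIV \<times> UNIV"
    by (rule summable_on_SigmaI[where g = "\<lambda>y. deg y * u y"]) (use col s w_nonneg u in auto)
  then have "((\<lambda>(y, x). w x y * u y) has_sum (\<Sum>\<^sub>\<infinity>y. deg y * u y)) (UNIV \<times> UNIV)"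
    using col s by (intro has_sum_SigmaI[where g = "\<lambda>y. deg y * u y"]) auto
  then have "((\<lambda>(x, y). w x y * u y) has_sum (\<Sum>\<^sub>\<infinity>y. deg y * u y)) (UNIV \<times> UNIV)"
    by (subst has_sum_swap) (simp add: case_prod_unfold)
  moreover have "((\<lambda>y. (\<lambda>(x, y). w x y * u y) (x, y)) has_sum (\<mu> x * nbr u x)) UNIV" for x
    using \<mu>_pos[of x] summable_w_bounded[of u C x] u
    by (simp add: nbr_def abs_of_nonneg)
  ultimately show ?thesis by (rule has_sum_SigmaD)
qed

lemma op_A_eq:
  assumes "\<And>y. 0 \<le> u y" "\<And>y. u y \<le> C"
  shows "op_A w \<kappa> \<mu> q u x = rate x * u x - nbr u x + u x powr q"
proof -
  have "nbr (\<lambda>y. u x - u y) x = u x * (deg x / \<mu> x) - nbr u x"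
    unfolding nbr_const[symmetric] using assms by (intro nbr_diff[of _ C _ C]) auto
  then have "laplacian w \<kappa> \<mu> u x = rate x * u x - nbr u x"
    by (simp add: laplacian_def nbr_def rate_def add_divide_distrib algebra_simps)
  moreover have "\<bar>u x\<bar> powr (q - 1) * u x = u x powr q"
    using assms(1)[of x] powr_mult_base[of "u x" "q - 1"] by (cases "u x = 0") (auto simp: mult.commute)
  ultimately show ?thesis
    by (simp add: op_A_def)
qed

section \<open>The minimal resolvent\<close>

text \<open>Picard iteration for \<open>v + l A v = f\<close> from below: the diagonal part and the absorption are solved
  exactly at each node, and the neighbours contribute their previous values. Starting from zero selects the
  minimal nonnegative solution, which is the one that receives nothing from infinity. The equation
  may have other solutions, so this choice matters.\<close>

primrec res_iter :: "real \<Rightarrow> ('a \<Rightarrow> real) \<Rightarrow> nat \<Rightarrow> 'a \<Rightarrow> real" where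
  "res_iter l f 0 = (\<lambda>x. 0)"
| "res_iter l f (Suc k) =
     (\<lambda>x. scalar_res (1 + l * rate x) l (f x + l * nbr (res_iter l f k) x))"

declare res_iter.simps(2) [simp del]

definition res :: "real \<Rightarrow> ('a \<Rightarrow> real) \<Rightarrow> 'a \<Rightarrow> real" where
  "res l f x = lim (\<lambda>k. res_iter l f k x)"

lemma one_plus_rate_pos: "0 < l \<Longrightarrow> 0 < 1 + l * rate x"
  using rate_nonneg[of x] by (simp add: add_pos_nonneg)

context
  fixes l :: real and f :: "'a \<Rightarrow> real"
  assumes l: "0 < l" and f: "\<And>x. 0 \<le> f x"
begin

lemma res_iter_nonneg: "0 \<le> res_iter l f k x"
proof (induction k arbitrary: x)
  case (Suc k)
  have "0 \<le> l * nbr (res_iter l f k) x"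
    using l nbr_nonneg[of "res_iter l f k" x] Suc by simp
  then show ?case
    unfolding res_iter.simps(2) using l f[of x] one_plus_rate_pos[OF l, of x]
    by (intro scalar_res) auto
qed simp

lemma res_iter_eq:
  "(1 + l * rate x) * res_iter l f (Suc k) x + l * res_iter l f (Suc k) x powr q
     = f x + l * nbr (res_iter l f k) x"
proof -
  have "0 \<le> l * nbr (res_iter l f k) x"
    using l nbr_nonneg[of "res_iter l f k" x] res_iter_nonneg by simp
  then show ?thesis
    unfolding res_iter.simps(2) using l f[of x] one_plus_rate_pos[OF l, of x]
    by (intro scalar_res) auto
qed

lemma res_iter_le_supersolution:
  assumes z: "\<And>x. 0 \<le> z x" "\<And>x. z x \<le> C"
    and super: "\<And>x. f x + l * nbr z x \<le> (1 + l * rate x) * z x + l * z x powr q"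
  shows "res_iter l f k x \<le> z x"
proof (induction k arbitrary: x)
  case 0
  then show ?case using z by simp
next
  case (Suc k)
  have "nbr (res_iter l f k) x \<le> nbr z x"
    using Suc z res_iter_nonneg by (intro nbr_mono[of _ C _ C]) (auto intro: order_trans)
  then have "l * nbr (res_iter l f k) x \<le> l * nbr z x" using l by simp
  then have "(1 + l * rate x) * res_iter l f (Suc k) x + l * res_iter l f (Suc k) x powr q
      \<le> (1 + l * rate x) * z x + l * z x powr q"
    using super[of x] unfolding res_iter_eq by linarith
  then show ?case
    by (rule absorption_cancel[OF one_plus_rate_pos[OF l] less_imp_le[OF l] res_iter_nonneg z(1)])
qed

text \<open>Constants \<open>c\<close> are supersolutions as soon as \<open>f \<le> c + l c powr q\<close>. Using this rather than \<open>f \<le> c\<close>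
  keeps the effect of the absorption, which is what makes the supremum decay.\<close>

lemma res_iter_le:
  assumes c: "0 \<le> c" and fc: "\<And>x. f x \<le> c + l * c powr q"
  shows "res_iter l f k x \<le> c"
proof (rule res_iter_le_supersolution[where C = c])
  fix x
  have "l * nbr (\<lambda>y. c) x \<le> l * (c * rate x)"
    using c l by (intro mult_left_mono nbr_le_rate) auto
  then show "f x + l * nbr (\<lambda>y. c) x \<le> (1 + l * rate x) * c + l * c powr q"
    using fc[of x] by (simp add: algebra_simps)
qed (use c in auto)

context
  fixes c :: real
  assumes c: "0 \<le> c" and fc: "\<And>x. f x \<le> c + l * c powr q"
begin

lemma res_iter_mono_Suc: "res_iter l f k x \<le> res_iter l f (Suc k) x"
proof (induction k arbitrary: x)
  case 0
  then show ?case using res_iter_nonneg[of 1] by simp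
next
  case (Suc k)
  have "nbr (res_iter l f k) x \<le> nbr (res_iter l f (Suc k)) x"
    using res_iter_nonneg[of k] res_iter_nonneg[of "Suc k"] res_iter_le[OF c fc]
    by (intro nbr_mono[of _ c _ c] Suc) (auto simp: abs_of_nonneg)
  then have "l * nbr (res_iter l f k) x \<le> l * nbr (res_iter l f (Suc k)) x" using l by simp
  then have "(1 + l * rate x) * res_iter l f (Suc k) x + l * res_iter l f (Suc k) x powr q
      \<le> (1 + l * rate x) * res_iter l f (Suc (Suc k)) x + l * res_iter l f (Suc (Suc k)) x powr q"
    unfolding res_iter_eq by linarith
  then show ?case
    by (rule absorption_cancel[OF one_plus_rate_pos[OF l] less_imp_le[OF l] res_iter_nonneg
          res_iter_nonneg])
qed

lemma res_tendsto: "(\<lambda>k. res_iter l f k x) \<longlonglongrightarrow> res l f x"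
proof -
  have "incseq (\<lambda>k. res_iter l f k x)"
    by (intro incseq_SucI res_iter_mono_Suc)
  moreover have "Bseq (\<lambda>k. res_iter l f k x)"
    using res_iter_nonneg res_iter_le[OF c fc] by (intro BseqI'[of _ c]) (simp add: abs_of_nonneg)
  ultimately show ?thesis unfolding res_def
    by (metis Bseq_mono_convergent convergent_LIMSEQ_iff incseq_def)
qed

lemma res_iter_le_res: "res_iter l f k x \<le> res l f x"
  by (rule incseq_le[OF incseq_SucI res_tendsto]) (rule res_iter_mono_Suc)

lemma res_nonneg: "0 \<le> res l f x"
  using res_iter_le_res[of 0] by simp

lemma res_le_supersolution:
  assumes "\<And>x. 0 \<le> z x" "\<And>x. z x \<le> C"
    and "\<And>x. f x + l * nbr z x \<le> (1 + l * rate x) * z x + l * z x powr q"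
  shows "res l f x \<le> z x"
  by (rule LIMSEQ_le_const2[OF res_tendsto]) (use res_iter_le_supersolution[OF assms] in auto)

lemma res_le: "res l f x \<le> c"
  by (rule LIMSEQ_le_const2[OF res_tendsto]) (use res_iter_le[OF c fc] in auto)

text \<open>One inequality follows since the iterates increase; for the other, the neighbour sum is tested on
  finite sets, where the limit of the iterates can be taken term by term.\<close>

lemma res_eq: "(1 + l * rate x) * res l f x + l * res l f x powr q = f x + l * nbr (res l f) x"
proof (rule antisym)
  let ?\<Psi> = "\<lambda>s. (1 + l * rate x) * s + l * s powr q"
  have lim: "(\<lambda>k. ?\<Psi> (res_iter l f (Suc k) x)) \<longlonglongrightarrow> ?\<Psi> (res l f x)"
    using q_pos res_iter_nonneg
    by (intro tendsto_intros tendsto_powr2 LIMSEQ_Suc[OF res_tendsto]) auto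
  have "?\<Psi> (res_iter l f (Suc k) x) \<le> f x + l * nbr (res l f) x" for k
    unfolding res_iter_eq using l res_iter_nonneg[of k] res_nonneg res_le res_iter_le[OF c fc]
    by (intro add_left_mono mult_left_mono nbr_mono[of _ c _ c] res_iter_le_res) auto
  then show "?\<Psi> (res l f x) \<le> f x + l * nbr (res l f) x"
    by (intro LIMSEQ_le_const2[OF lim]) auto
  have "(\<Sum>\<^sub>\<infinity>y. w x y * res l f y) \<le> (?\<Psi> (res l f x) - f x) / l * \<mu> x"
  proof (rule infsum_le_finite_sums)
    show "(\<lambda>y. w x y * res l f y) summable_on UNIV"
      using res_nonneg res_le by (intro summable_w_bounded[of _ c]) auto
    fix F :: "'a set" assume F: "finite F"
    have "(\<Sum>y\<in>F. w x y * res_iter l f k y) \<le> (?\<Psi> (res_iter l f (Suc k) x) - f x) / l * \<mu> x" for k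
    proof -
      have "(\<Sum>y\<in>F. w x y * res_iter l f k y) \<le> (\<Sum>\<^sub>\<infinity>y. w x y * res_iter l f k y)"
        using F w_nonneg res_iter_nonneg res_iter_le[OF c fc]
        by (intro finite_sum_le_infsum summable_w_bounded[of _ c]) auto
      also have "\<dots> = (?\<Psi> (res_iter l f (Suc k) x) - f x) / l * \<mu> x"
        unfolding res_iter_eq using l \<mu>_pos[of x] by (simp add: nbr_def)
      finally show ?thesis .
    qed
    then show "(\<Sum>y\<in>F. w x y * res l f y) \<le> (?\<Psi> (res l f x) - f x) / l * \<mu> x"
      using l by (intro LIMSEQ_le[OF tendsto_sum[OF tendsto_mult[OF tendsto_const res_tendsto]]
        tendsto_mult[OF tendsto_divide[OF tendsto_diff[OF lim tendsto_const] tendsto_const] tendsto_const]])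
        auto
  qed
  then have "nbr (res l f) x \<le> (?\<Psi> (res l f x) - f x) / l"
    using \<mu>_pos[of x] by (simp add: nbr_def pos_divide_le_eq)
  then show "f x + l * nbr (res l f) x \<le> ?\<Psi> (res l f x)"
    using l by (simp add: pos_le_divide_eq mult.commute)
qed

end

end

lemma bounded_le_absorption: "0 \<le> C \<Longrightarrow> 0 < l \<Longrightarrow> f \<le> C \<Longrightarrow> f \<le> C + l * C powr q"
  by (smt (verit) mult_nonneg_nonneg powr_ge_zero)

text \<open>\<open>v = res l f\<close> does solve the equation that defines the left-hand side, so it dominates the minimal
  solution \<open>z\<close> there. Conversely \<open>z\<close>, because \<open>z \<le> v\<close>, is a supersolution of the equation with step \<open>l\<close>, and
  therefore lies above every iterate that builds \<open>v\<close>.\<close>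

lemma res_resolvent_identity:
  assumes s: "0 < s" "s \<le> l" and f: "\<And>x. 0 \<le> f x" "\<And>x. f x \<le> C"
  shows "res s (\<lambda>x. (1 - s / l) * res l f x + s / l * f x) = res l f"
proof
  fix x
  have l: "0 < l" using s by linarith
  have C: "0 \<le> C" using f[of undefined] by linarith
  note fC = bounded_le_absorption[OF C l f(2)]
  let ?v = "res l f"
  let ?t = "s / l"
  let ?g = "\<lambda>x. (1 - ?t) * ?v x + ?t * f x"
  have t: "0 \<le> ?t" "?t \<le> 1" using s l by auto
  have v: "0 \<le> ?v x" "?v x \<le> C" for x
    using res_nonneg[OF l f(1) C fC] res_le[OF l f(1) C fC] by auto
  have g0: "0 \<le> ?g x" for x
    using v f t by (intro add_nonneg_nonneg mult_nonneg_nonneg) auto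
  have gC: "?g x \<le> C" for x
    using convex_bound_le[of "?v x" C "f x" "1 - ?t" ?t] v f t by simp
  note gC' = bounded_le_absorption[OF C s(1) gC]
  let ?z = "res s ?g"
  have z: "0 \<le> ?z x" for x using res_nonneg[OF s(1) g0 C gC'] .
  have zv: "?z x \<le> ?v x" for x
  proof (rule res_le_supersolution[OF s(1) g0 C gC' v])
    fix x
    have "?t * ((1 + l * rate x) * ?v x + l * ?v x powr q) = ?t * (f x + l * nbr ?v x)"
      using res_eq[OF l f(1) C fC, of x] by simp
    then show "?g x + s * nbr ?v x \<le> (1 + s * rate x) * ?v x + s * ?v x powr q"
      using l by (simp add: field_simps)
  qed
  have zC: "?z x \<le> C" for x using zv v order_trans by blast
  have vz: "res_iter l f k x \<le> ?z x" for k x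
  proof (rule res_iter_le_supersolution[OF l f(1) z zC])
    fix x
    have "(1 + s * rate x) * ?z x + s * ?z x powr q = ?g x + s * nbr ?z x"
      using res_eq[OF s(1) g0 C gC', of x] .
    moreover have "(1 - ?t) * ?z x \<le> (1 - ?t) * ?v x"
      using zv[of x] t by (intro mult_left_mono) auto
    ultimately have "?t * f x + s * nbr ?z x \<le> (?t + s * rate x) * ?z x + s * ?z x powr q"
      by (simp add: algebra_simps)
    then have "?t * (f x + l * nbr ?z x) \<le> ?t * ((1 + l * rate x) * ?z x + l * ?z x powr q)"
      using l by (simp add: algebra_simps)
    then show "f x + l * nbr ?z x \<le> (1 + l * rate x) * ?z x + l * ?z x powr q"
      using s l by (subst (asm) mult_le_cancel_left_pos) auto
  qed
  have "?v x \<le> ?z x"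
    by (rule LIMSEQ_le_const2[OF res_tendsto[OF l f(1) C fC]]) (use vz in auto)
  then show "?z x = ?v x" using zv[of x] by simp
qed

section \<open>Contractivity of the resolvent\<close>

lemma abs_res_iter_diff_le:
  assumes l: "0 < l" and f: "\<And>x. 0 \<le> f x" "\<And>x. f x \<le> C" and g: "\<And>x. 0 \<le> g x" "\<And>x. g x \<le> C"
  shows "(1 + l * rate x) * \<bar>res_iter l f (Suc k) x - res_iter l g (Suc k) x\<bar>
    \<le> \<bar>f x - g x\<bar> + l * nbr (\<lambda>y. \<bar>res_iter l f k y - res_iter l g k y\<bar>) x"
proof -
  have C: "0 \<le> C" using f[of undefined] by linarith
  note fC = bounded_le_absorption[OF C l f(2)] and gC = bounded_le_absorption[OF C l g(2)]
  let ?u = "res_iter l f" and ?v = "res_iter l g"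
  have u: "0 \<le> ?u k x" "?u k x \<le> C" for k x
    using res_iter_nonneg[OF l f(1)] res_iter_le[OF l f(1) C fC] by auto
  have v: "0 \<le> ?v k x" "?v k x \<le> C" for k x
    using res_iter_nonneg[OF l g(1)] res_iter_le[OF l g(1) C gC] by auto
  have "(1 + l * rate x) * \<bar>?u (Suc k) x - ?v (Suc k) x\<bar>
      \<le> \<bar>(f x + l * nbr (?u k) x) - (g x + l * nbr (?v k) x)\<bar>"
    using absorption_diff[of "1 + l * rate x" l "?u (Suc k) x" "?v (Suc k) x"]
      u v l one_plus_rate_pos[OF l, of x] res_iter_eq[OF l f(1), where x = x and k = k]
      res_iter_eq[OF l g(1), where x = x and k = k]
    by simp
  also have "\<dots> = \<bar>(f x - g x) + l * nbr (\<lambda>y. ?u k y - ?v k y) x\<bar>"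
    using u v by (subst nbr_diff[of _ C _ C]) (auto simp: algebra_simps)
  also have "\<dots> \<le> \<bar>f x - g x\<bar> + l * \<bar>nbr (\<lambda>y. ?u k y - ?v k y) x\<bar>"
    using abs_triangle_ineq[of "f x - g x" "l * nbr (\<lambda>y. ?u k y - ?v k y) x"] l
    by (simp add: abs_mult)
  also have "\<dots> \<le> \<bar>f x - g x\<bar> + l * nbr (\<lambda>y. \<bar>?u k y - ?v k y\<bar>) x"
  proof -
    have "\<bar>?u k y - ?v k y\<bar> \<le> C" for y
      using u[of k y] v[of k y] by (simp add: abs_le_iff)
    then show ?thesis
      using l by (intro add_left_mono mult_left_mono abs_nbr_le[of _ C]) auto
  qed
  finally show ?thesis .
qed

text \<open>The same iteration without absorption. It dominates \<open>p\<close>-th powers of differences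
  and, being linear, has a computable total mass.\<close>

primrec lin_iter :: "real \<Rightarrow> ('a \<Rightarrow> real) \<Rightarrow> nat \<Rightarrow> 'a \<Rightarrow> real" where
  "lin_iter l G 0 = (\<lambda>x. 0)"
| "lin_iter l G (Suc k) = (\<lambda>x. (G x + l * nbr (lin_iter l G k) x) / (1 + l * rate x))"

declare lin_iter.simps(2) [simp del]

lemma lin_iter_bounds:
  assumes l: "0 < l" and G: "\<And>x. 0 \<le> G x" "\<And>x. G x \<le> C"
  shows "0 \<le> lin_iter l G k x \<and> lin_iter l G k x \<le> C"
proof (induction k arbitrary: x)
  case 0
  then show ?case using G[of x] by simp
next
  case (Suc k)
  have "0 \<le> nbr (lin_iter l G k) x" "nbr (lin_iter l G k) x \<le> C * rate x"
    using Suc by (auto intro!: nbr_nonneg nbr_le_rate)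
  then have "l * nbr (lin_iter l G k) x \<le> l * (C * rate x)" "0 \<le> l * nbr (lin_iter l G k) x"
    using l by auto
  then show ?case
    using G[of x] one_plus_rate_pos[OF l, of x]
    by (auto simp: lin_iter.simps(2) pos_divide_le_eq algebra_simps)
qed

lemma lin_iter_mono_Suc:
  assumes l: "0 < l" and G: "\<And>x. 0 \<le> G x" "\<And>x. G x \<le> C"
  shows "lin_iter l G k x \<le> lin_iter l G (Suc k) x"
proof (induction k arbitrary: x)
  case 0
  then show ?case using lin_iter_bounds[OF assms, where k = 1 and x = x] by simp
next
  case (Suc k)
  have "nbr (lin_iter l G k) x \<le> nbr (lin_iter l G (Suc k)) x"
    using lin_iter_bounds[OF assms] Suc by (intro nbr_mono[of _ C _ C]) (auto simp: abs_of_nonneg)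
  then show ?case
    using l one_plus_rate_pos[OF l, of x] unfolding lin_iter.simps(2)
    by (intro divide_right_mono add_left_mono mult_left_mono) auto
qed

text \<open>Summing the equation over all nodes, the mass \<open>deg * lin_iter\<close> that leaves in step \<open>Suc k\<close> is at least the
  mass that arrives from step \<open>k\<close>, since the iterates increase. Both are finite for every \<open>k\<close> but
  possibly not in the limit, so the cancellation has to be done before \<open>k\<close> tends to infinity.\<close>

lemma lin_iter_total:
  assumes l: "0 < l" and G: "\<And>x. 0 \<le> G x" "\<And>x. G x \<le> C"
    and s: "(\<lambda>x. G x * \<mu> x) summable_on UNIV"
  shows "(\<lambda>x. lin_iter l G k x * \<mu> x) summable_on UNIV \<and>
    (\<lambda>x. deg x * lin_iter l G k x) summable_on UNIV \<and>
    (\<Sum>\<^sub>\<infinity>x. lin_iter l G k x * \<mu> x) \<le> (\<Sum>\<^sub>\<infinity>x. G x * \<mu> x)"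
proof (induction k)
  case 0
  have "0 \<le> (\<Sum>\<^sub>\<infinity>x. G x * \<mu> x)" using G less_imp_le[OF \<mu>_pos] by (intro infsum_nonneg) (auto intro!: mult_nonneg_nonneg)
  then show ?case by simp
next
  case (Suc k)
  let ?u = "lin_iter l G"
  note u = lin_iter_bounds[OF l G]
  have balance: "?u (Suc k) x * \<mu> x + l * ((deg x + \<kappa> x) * ?u (Suc k) x) = G x * \<mu> x + l * (\<mu> x * nbr (?u k) x)" for x
  proof -
    have "(1 + l * rate x) * ?u (Suc k) x = G x + l * nbr (?u k) x"
      using one_plus_rate_pos[OF l, of x] by (simp add: lin_iter.simps(2))
    then have "\<mu> x * ((1 + l * rate x) * ?u (Suc k) x) = \<mu> x * (G x + l * nbr (?u k) x)" by simp
    moreover have "\<mu> x * (1 + l * rate x) = \<mu> x + l * (deg x + \<kappa> x)"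
    proof -
      have "\<mu> x * rate x = deg x + \<kappa> x" using \<mu>_pos[of x] by (simp add: rate_def)
      then show ?thesis by (simp add: distrib_left mult.left_commute)
    qed
    ultimately have "(\<mu> x + l * (deg x + \<kappa> x)) * ?u (Suc k) x = \<mu> x * (G x + l * nbr (?u k) x)"
      by (metis mult.assoc)
    then show ?thesis by (simp add: algebra_simps)
  qed
  have sum: "((\<lambda>x. G x * \<mu> x + l * (\<mu> x * nbr (?u k) x)) has_sum
      ((\<Sum>\<^sub>\<infinity>x. G x * \<mu> x) + l * (\<Sum>\<^sub>\<infinity>x. deg x * ?u k x))) UNIV"
    using u Suc s by (intro has_sum_add has_sum_cmult_right nbr_total[of _ C]) auto
  then have sum': "(\<lambda>x. G x * \<mu> x + l * (\<mu> x * nbr (?u k) x)) summable_on UNIV"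
    by (rule has_sum_imp_summable)
  have nn: "0 \<le> ?u (Suc k) x * \<mu> x" "0 \<le> l * (deg x * ?u (Suc k) x)" "0 \<le> l * (\<kappa> x * ?u (Suc k) x)" for x
    using u[where k = "Suc k" and x = x] \<mu>_pos[of x] deg_nonneg[of x] \<kappa>_nonneg[of x] l by auto
  have split: "?u (Suc k) x * \<mu> x + l * (deg x * ?u (Suc k) x) \<le> G x * \<mu> x + l * (\<mu> x * nbr (?u k) x)" for x
    using balance[of x] nn(3)[of x] by (simp add: algebra_simps)
  have s1: "(\<lambda>x. ?u (Suc k) x * \<mu> x) summable_on UNIV"
    by (rule summable_on_comparison_test[OF sum']) (use nn split in \<open>smt (verit)\<close>)+
  have s2': "(\<lambda>x. l * (deg x * ?u (Suc k) x)) summable_on UNIV"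
    by (rule summable_on_comparison_test[OF sum']) (use nn split in \<open>smt (verit)\<close>)+
  then have s2: "(\<lambda>x. deg x * ?u (Suc k) x) summable_on UNIV"
    using summable_on_cmult_right[OF s2', of "1 / l"] l by simp
  have "(\<Sum>\<^sub>\<infinity>x. ?u (Suc k) x * \<mu> x) + l * (\<Sum>\<^sub>\<infinity>x. deg x * ?u (Suc k) x)
      = (\<Sum>\<^sub>\<infinity>x. ?u (Suc k) x * \<mu> x + l * (deg x * ?u (Suc k) x))"
    using s1 s2' by (subst infsum_add) (auto simp: infsum_cmult_right')
  also have "\<dots> \<le> (\<Sum>\<^sub>\<infinity>x. G x * \<mu> x + l * (\<mu> x * nbr (?u k) x))"
    using s1 s2' sum' split by (intro infsum_mono) (auto intro: summable_on_add)
  also have "\<dots> = (\<Sum>\<^sub>\<infinity>x. G x * \<mu> x) + l * (\<Sum>\<^sub>\<infinity>x. deg x * ?u k x)"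
    using sum by (rule infsumI)
  also have "l * (\<Sum>\<^sub>\<infinity>x. deg x * ?u k x) \<le> l * (\<Sum>\<^sub>\<infinity>x. deg x * ?u (Suc k) x)"
    using l s2 Suc lin_iter_mono_Suc[OF l G] deg_nonneg
    by (intro mult_left_mono infsum_mono) auto
  finally show ?case using s1 s2 by simp
qed

text \<open>Jensen's inequality for a sub-probability: \<open>a\<close> is the mean of \<open>b0\<close> and the values \<open>b y\<close> with
  weights proportional to \<open>1\<close> and \<open>l * w x y / \<mu> x\<close>, where killing moves the missing weight to the value
  \<open>0\<close>. The tangent at \<open>a\<close> is summed against these weights.\<close>

lemma nbr_jensen:
  assumes p: "1 \<le> p" and l: "0 < l" and b0: "0 \<le> b0" and b: "\<And>y. 0 \<le> b y" "\<And>y. b y \<le> C"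
    and a: "(1 + l * rate x) * a = b0 + l * nbr b x"
  shows "(1 + l * rate x) * a powr p \<le> b0 powr p + l * nbr (\<lambda>y. b y powr p) x"
proof -
  have "0 \<le> (1 + l * rate x) * a"
    using a b0 l nbr_nonneg[of b x] b by simp
  then have a0: "0 \<le> a" using one_plus_rate_pos[OF l, of x] by (simp add: zero_le_mult_iff)
  have aa: "a powr (p - 1) * a = a powr p"
    using a0 powr_mult_base[of a "p - 1"] by (cases "a = 0") (auto simp: mult.commute)
  have bp: "\<bar>b y powr p\<bar> \<le> C powr p" for y
    using b[of y] p by (simp add: powr_mono2)
  define D where "D = deg x / \<mu> x"
  have D: "D \<le> rate x" unfolding D_def by (rule deg_le_rate)
  have "nbr (\<lambda>y. (a powr p - p * a powr p) + p * a powr (p - 1) * b y) x \<le> nbr (\<lambda>y. b y powr p) x"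
  proof (rule nbr_mono[OF _ bp])
    fix y
    have "p * a powr (p - 1) * a = p * a powr p" using aa by simp
    then show "(a powr p - p * a powr p) + p * a powr (p - 1) * b y \<le> b y powr p"
      using powr_tangent_le[OF p a0 b(1)[of y]] unfolding right_diff_distrib by linarith
    have "p * a powr (p - 1) * b y \<le> p * a powr (p - 1) * C" "0 \<le> p * a powr (p - 1) * b y"
      using b[of y] p by (auto intro!: mult_left_mono)
    then show "\<bar>(a powr p - p * a powr p) + p * a powr (p - 1) * b y\<bar>
        \<le> \<bar>a powr p - p * a powr p\<bar> + p * a powr (p - 1) * C" by linarith
  qed
  moreover have "nbr (\<lambda>y. (a powr p - p * a powr p) + p * a powr (p - 1) * b y) x
      = (a powr p - p * a powr p) * D + p * a powr (p - 1) * nbr b x"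
  proof (subst nbr_add[of _ "\<bar>a powr p - p * a powr p\<bar>" _ "\<bar>p * a powr (p - 1)\<bar> * C"])
    show "\<bar>p * a powr (p - 1) * b y\<bar> \<le> \<bar>p * a powr (p - 1)\<bar> * C" for y
      using b[of y] unfolding abs_mult[of "p * a powr (p - 1)"] by (intro mult_left_mono) auto
  qed (auto simp: nbr_const nbr_cmult D_def)
  ultimately have N: "l * ((a powr p - p * a powr p) * D + p * a powr (p - 1) * nbr b x)
      \<le> l * nbr (\<lambda>y. b y powr p) x"
    using l by simp
  have B: "a powr p + p * a powr (p - 1) * (b0 - a) \<le> b0 powr p"
    by (rule powr_tangent_le[OF p a0 b0])
  have "(1 + l * rate x) * (p * a powr p) = p * a powr (p - 1) * ((1 + l * rate x) * a)"
    unfolding aa[symmetric] by (simp add: mult_ac)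
  then have E: "(1 + l * rate x) * (p * a powr p)
      = p * a powr (p - 1) * b0 + l * (p * a powr (p - 1) * nbr b x)"
    unfolding a by (simp add: algebra_simps)
  have "0 \<le> l * (rate x - D) * ((p - 1) * a powr p)"
    using l D p by simp
  then have R: "(1 + l * rate x) * a powr p
      \<le> (1 + l * D) * (a powr p - p * a powr p) + (1 + l * rate x) * (p * a powr p)"
    by (simp add: algebra_simps)
  have "p * a powr (p - 1) * (b0 - a) = p * a powr (p - 1) * b0 - p * a powr p"
    using aa by (simp add: right_diff_distrib)
  moreover have "l * ((a powr p - p * a powr p) * D + p * a powr (p - 1) * nbr b x)
      = l * D * (a powr p - p * a powr p) + l * (p * a powr (p - 1) * nbr b x)"
    by (simp add: algebra_simps)
  moreover have "(1 + l * D) * (a powr p - p * a powr p)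
      = a powr p - p * a powr p + l * D * (a powr p - p * a powr p)"
    by (simp add: algebra_simps)
  ultimately show ?thesis
    using R N B E by linarith
qed

lemma res_iter_diff_powr_le:
  assumes p: "1 \<le> p" and l: "0 < l"
    and f: "\<And>x. 0 \<le> f x" "\<And>x. f x \<le> C" and g: "\<And>x. 0 \<le> g x" "\<And>x. g x \<le> C"
  shows "\<bar>res_iter l f k x - res_iter l g k x\<bar> powr p
    \<le> lin_iter l (\<lambda>x. \<bar>f x - g x\<bar> powr p) k x"
proof (induction k arbitrary: x)
  case 0
  then show ?case using p by simp
next
  case (Suc k)
  have C: "0 \<le> C" using f[of undefined] by linarith
  define d where "d k x = \<bar>res_iter l f k x - res_iter l g k x\<bar>" for k x
  have d: "0 \<le> d k x" "d k x \<le> C" for k x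
    using res_iter_nonneg[where f = f, OF l f(1), where k = k and x = x]
      res_iter_le[where f = f, OF l f(1) C bounded_le_absorption[OF C l f(2)], where k = k and x = x]
      res_iter_nonneg[where f = g, OF l g(1), where k = k and x = x]
      res_iter_le[where f = g, OF l g(1) C bounded_le_absorption[OF C l g(2)], where k = k and x = x]
    by (auto simp: d_def abs_le_iff)
  note pos = one_plus_rate_pos[OF l, of x]
  define a where "a = (\<bar>f x - g x\<bar> + l * nbr (d k) x) / (1 + l * rate x)"
  have "(1 + l * rate x) * d (Suc k) x \<le> \<bar>f x - g x\<bar> + l * nbr (d k) x"
    unfolding d_def by (rule abs_res_iter_diff_le[OF l f g])
  then have "d (Suc k) x \<le> a" using pos by (simp add: a_def pos_le_divide_eq mult.commute)
  then have "(1 + l * rate x) * d (Suc k) x powr p \<le> (1 + l * rate x) * a powr p"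
    using d p pos by (intro mult_left_mono powr_mono2) auto
  also have "\<dots> \<le> \<bar>f x - g x\<bar> powr p + l * nbr (\<lambda>y. d k y powr p) x"
    using pos by (intro nbr_jensen[OF p l _ d]) (auto simp: a_def)
  also have "\<dots> \<le> \<bar>f x - g x\<bar> powr p + l * nbr (lin_iter l (\<lambda>x. \<bar>f x - g x\<bar> powr p) k) x"
  proof (intro add_left_mono mult_left_mono nbr_mono[of _ "C powr p" _ "C powr p"])
    show "d k y powr p \<le> lin_iter l (\<lambda>x. \<bar>f x - g x\<bar> powr p) k y" for y
      using Suc[of y] by (simp add: d_def)
    show "\<bar>d k y powr p\<bar> \<le> C powr p" for y
      using d[of k y] p by (simp add: powr_mono2)
    have "\<bar>f y - g y\<bar> \<le> C" for y
      using f[of y] g[of y] by (simp add: abs_le_iff)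
    then show "\<bar>lin_iter l (\<lambda>x. \<bar>f x - g x\<bar> powr p) k y\<bar> \<le> C powr p" for y
      using lin_iter_bounds[OF l, of "\<lambda>x. \<bar>f x - g x\<bar> powr p" "C powr p" k y] p
      by (simp add: powr_mono2)
  qed (use l in auto)
  finally show ?case
    using pos by (simp add: d_def lin_iter.simps(2) pos_le_divide_eq mult.commute)
qed

text \<open>The contraction holds for the iterates uniformly, because their differences to the power \<open>p\<close> stay below the
  linear iteration driven by \<open>\<bar>f - g\<bar> powr p\<close>, whose mass is controlled. Fatou's lemma passes it
  to the limit.\<close>

lemma res_contraction:
  assumes p: "1 \<le> p" and l: "0 < l"
    and f: "\<And>x. 0 \<le> f x" "\<And>x. f x \<le> C" and g: "\<And>x. 0 \<le> g x" "\<And>x. g x \<le> C"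
    and fg: "(\<lambda>x. f x - g x) \<in> lp_space p \<mu>"
  shows "(\<lambda>x. res l f x - res l g x) \<in> lp_space p \<mu> \<and>
    lp_norm p \<mu> (\<lambda>x. res l f x - res l g x) \<le> lp_norm p \<mu> (\<lambda>x. f x - g x)"
proof (rule lp_fatou[where z = "\<lambda>k x. res_iter l f k x - res_iter l g k x", OF p \<mu>_pos])
  have C: "0 \<le> C" using f[of undefined] by linarith
  show "(\<lambda>k. res_iter l f k x - res_iter l g k x) \<longlonglongrightarrow> res l f x - res l g x" for x
    using res_tendsto[OF l f(1) C bounded_le_absorption[OF C l f(2)]]
      res_tendsto[OF l g(1) C bounded_le_absorption[OF C l g(2)]]
    by (intro tendsto_diff)
  let ?G = "\<lambda>x. \<bar>f x - g x\<bar> powr p"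
  have "\<bar>f y - g y\<bar> \<le> C" for y
    using f[of y] g[of y] by (simp add: abs_le_iff)
  then have G: "\<And>x. 0 \<le> ?G x" "\<And>x. ?G x \<le> C powr p" using p by (auto intro: powr_mono2)
  have s: "(\<lambda>x. ?G x * \<mu> x) summable_on UNIV" using fg by (simp add: lp_space_def)
  have "(\<Sum>x\<in>F. \<bar>res_iter l f k x - res_iter l g k x\<bar> powr p * \<mu> x)
      \<le> lp_norm p \<mu> (\<lambda>x. f x - g x) powr p" if "finite F" for k F
  proof -
    have "(\<Sum>x\<in>F. \<bar>res_iter l f k x - res_iter l g k x\<bar> powr p * \<mu> x)
        \<le> (\<Sum>x\<in>F. lin_iter l ?G k x * \<mu> x)"
      using \<mu>_pos by (intro sum_mono mult_right_mono res_iter_diff_powr_le[OF p l f g]) (auto intro: less_imp_le)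
    also have "\<dots> \<le> (\<Sum>\<^sub>\<infinity>x. lin_iter l ?G k x * \<mu> x)"
      using that lin_iter_total[OF l G s, of k] lin_iter_bounds[OF l G] less_imp_le[OF \<mu>_pos]
      by (intro finite_sum_le_infsum) (auto intro!: mult_nonneg_nonneg)
    also have "\<dots> \<le> (\<Sum>\<^sub>\<infinity>x. ?G x * \<mu> x)" using lin_iter_total[OF l G s] by simp
    also have "\<dots> = lp_norm p \<mu> (\<lambda>x. f x - g x) powr p"
      using lp_norm_powr[where \<mu> = \<mu>, OF p \<mu>_pos] by simp
    finally show ?thesis .
  qed
  then show "\<forall>\<^sub>F k in sequentially. (\<lambda>x. res_iter l f k x - res_iter l g k x) \<in> lp_space p \<mu> \<and>
      lp_norm p \<mu> (\<lambda>x. res_iter l f k x - res_iter l g k x) \<le> lp_norm p \<mu> (\<lambda>x. f x - g x)"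
    using lp_bound_iff_finite_sums[where \<mu> = \<mu>, OF p \<mu>_pos lp_norm_nonneg] by (intro always_eventually allI) blast
qed simp

end

section \<open>Convergence of the implicit Euler scheme\<close>

locale lp_absorption_graph = absorption_graph +
  fixes p :: real
  assumes p: "1 \<le> p"
begin

text \<open>The invariant class of data: here the minimal solution exists, and the resolvent
  preserves the class.\<close>

definition admissible :: "real \<Rightarrow> ('a \<Rightarrow> real) \<Rightarrow> bool" where
  "admissible C f \<longleftrightarrow> f \<in> lp_space p \<mu> \<and> (\<forall>x. 0 \<le> f x \<and> f x \<le> C)"

lemma admissibleD:
  assumes "admissible C f"
  shows "f \<in> lp_space p \<mu>" "0 \<le> f x" "f x \<le> C" "0 \<le> C"
proof -
  show "f \<in> lp_space p \<mu>" "0 \<le> f x" "f x \<le> C" for x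
    using assms by (auto simp: admissible_def)
  from this(2,3)[of undefined] show "0 \<le> C" by linarith
qed

lemmas lp_diff = lp_space_diff[where \<mu> = \<mu>, OF p \<mu>_pos]

lemmas lp_triangle = lp_norm_triangle_diff[where \<mu> = \<mu>, OF p \<mu>_pos]

lemma admissible_diff_lp:
  "admissible C f \<Longrightarrow> admissible C g \<Longrightarrow> (\<lambda>x. f x - g x) \<in> lp_space p \<mu>"
  by (intro lp_diff admissibleD)

lemma admissible_res_facts:
  assumes l: "0 < l" and f: "admissible C f"
  shows "0 \<le> res l f x" and "res l f x \<le> C"
    and "(1 + l * rate x) * res l f x + l * res l f x powr q = f x + l * nbr (res l f) x"
  using res_nonneg[where f = f, OF l admissibleD(2)[OF f] admissibleD(4)[OF f]
      bounded_le_absorption[OF admissibleD(4)[OF f] l admissibleD(3)[OF f]]]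
    res_le[where f = f, OF l admissibleD(2)[OF f] admissibleD(4)[OF f]
      bounded_le_absorption[OF admissibleD(4)[OF f] l admissibleD(3)[OF f]]]
    res_eq[where f = f, OF l admissibleD(2)[OF f] admissibleD(4)[OF f]
      bounded_le_absorption[OF admissibleD(4)[OF f] l admissibleD(3)[OF f]]]
  by blast+

lemma lp_norm_res_diff_le:
  assumes l: "0 < l" and f: "admissible C f" and g: "admissible C g"
  shows "lp_norm p \<mu> (\<lambda>x. res l f x - res l g x) \<le> lp_norm p \<mu> (\<lambda>x. f x - g x)"
    and "(\<lambda>x. res l f x - res l g x) \<in> lp_space p \<mu>"
  using res_contraction[where f = f and g = g, OF p l admissibleD(2)[OF f] admissibleD(3)[OF f]
      admissibleD(2)[OF g] admissibleD(3)[OF g] admissible_diff_lp[OF f g]]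
  by auto

lemma admissible_zero: "0 \<le> C \<Longrightarrow> admissible C (\<lambda>x. 0)"
  using p by (simp add: admissible_def lp_space_def)

lemma res_zero:
  assumes l: "0 < l" shows "res l (\<lambda>x. 0) x = 0"
  using admissible_res_facts(1,2)[OF l admissible_zero[of 0], of x] by simp

lemma admissible_res:
  assumes l: "0 < l" and f: "admissible C f"
  shows "admissible C (res l f)" and "lp_norm p \<mu> (res l f) \<le> lp_norm p \<mu> f"
  using lp_norm_res_diff_le[OF l f admissible_zero[OF admissibleD(4)[OF f]]]
    admissible_res_facts(1,2)[OF l f]
  by (auto simp: res_zero[OF l] admissible_def)

lemma res_identity:
  assumes "0 < s" "s \<le> l" and f: "admissible C f"
  shows "res s (\<lambda>x. (1 - s / l) * res l f x + s / l * f x) = res l f"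
  by (rule res_resolvent_identity[OF assms(1,2) admissibleD(2,3)[OF f]])

lemma admissible_convex:
  assumes f: "admissible C f" and g: "admissible C g" and t: "0 \<le> t" "t \<le> 1"
  shows "admissible C (\<lambda>x. (1 - t) * f x + t * g x)"
proof -
  have "(\<lambda>x. (1 - t) * f x + t * g x) \<in> lp_space p \<mu>"
    by (intro lp_space_add[where \<mu> = \<mu>, OF p \<mu>_pos] lp_space_cmult admissibleD[OF f] admissibleD[OF g])
  moreover have "(1 - t) * f x + t * g x \<le> C" for x
    using t admissibleD(3)[OF f] admissibleD(3)[OF g] by (intro convex_bound_le) auto
  ultimately show ?thesis
    using t admissibleD(2)[OF f] admissibleD(2)[OF g] by (auto simp: admissible_def)
qed

lemma res_op_A_dom:
  assumes l: "0 < l" and f: "admissible C f"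
  shows "res l f \<in> op_A_dom w \<kappa> \<mu> p q" "res l f x + l * op_A w \<kappa> \<mu> q (res l f) x = f x"
proof -
  note v = admissible_res_facts[OF l f]
  have A: "op_A w \<kappa> \<mu> q (res l f) x = 1 / l * (f x - res l f x)" for x
  proof -
    have "f x - res l f x = l * (rate x * res l f x - nbr (res l f) x + res l f x powr q)"
      using v(3)[of x] by (simp add: algebra_simps)
    then show ?thesis using op_A_eq[of "res l f" C x] v(1,2) l by simp
  qed
  show "res l f x + l * op_A w \<kappa> \<mu> q (res l f) x = f x" unfolding A using l by simp
  have "op_A w \<kappa> \<mu> q (res l f) \<in> lp_space p \<mu>"
    unfolding A[abs_def] by (intro lp_space_cmult admissible_diff_lp[of C] admissible_res[OF l] f)
  moreover have "res l f \<in> laplacian_dom w"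
    unfolding laplacian_dom_def using v(1,2) by (auto intro!: summable_w_bounded[of _ C])
  ultimately show "res l f \<in> op_A_dom w \<kappa> \<mu> p q"
    using admissible_res(1)[OF l f] by (simp add: op_A_dom_def admissible_def)
qed

text \<open>Both resolvents are rewritten with the common smaller step \<open>l r / (l + r)\<close>, half the harmonic mean
  of \<open>l\<close> and \<open>r\<close>. Contractivity of that resolvent and the
  triangle inequality give exactly the recursion of \<open>double_sequence_bound\<close>.\<close>

lemma two_step_inequality:
  assumes l: "0 < l" and r: "0 < r" and f: "admissible C f" and g: "admissible C g"
  shows "(l + r) * lp_norm p \<mu> (\<lambda>x. res l f x - res r g x)
    \<le> r * lp_norm p \<mu> (\<lambda>x. f x - res r g x) + l * lp_norm p \<mu> (\<lambda>x. res l f x - g x)"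
proof -
  let ?u = "res l f" and ?v = "res r g"
  define s where "s = l * r / (l + r)"
  have s: "0 < s" "s \<le> l" "s \<le> r" "s / l = r / (l + r)" "s / r = l / (l + r)"
    using l r by (auto simp: s_def pos_divide_le_eq distrib_left)
  have t: "0 \<le> r / (l + r)" "r / (l + r) \<le> 1" "0 \<le> l / (l + r)" "l / (l + r) \<le> 1"
    using l r by auto
  have uv: "admissible C ?u" "admissible C ?v"
    using admissible_res l r f g by auto
  let ?F = "\<lambda>x. (1 - s / l) * ?u x + s / l * f x" and ?G = "\<lambda>x. (1 - s / r) * ?v x + s / r * g x"
  have FG: "admissible C ?F" "admissible C ?G"
    using t unfolding s(4,5) by (auto simp del: times_divide_eq_left intro!: admissible_convex uv f g)
  have "lp_norm p \<mu> (\<lambda>x. ?u x - ?v x) = lp_norm p \<mu> (\<lambda>x. res s ?F x - res s ?G x)"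
    unfolding res_identity[OF s(1,2) f] res_identity[OF s(1,3) g] ..
  also have "\<dots> \<le> lp_norm p \<mu> (\<lambda>x. ?F x - ?G x)"
    by (rule lp_norm_res_diff_le[OF s(1) FG])
  also have "(\<lambda>x. ?F x - ?G x) = (\<lambda>x. r / (l + r) * (f x - ?v x) + l / (l + r) * (?u x - g x))"
  proof
    fix x
    have e: "1 - r / (l + r) = l / (l + r)" "1 - l / (l + r) = r / (l + r)"
      using l r by (auto simp: field_simps)
    show "?F x - ?G x = r / (l + r) * (f x - ?v x) + l / (l + r) * (?u x - g x)"
      unfolding s(4,5) e by (simp add: algebra_simps)
  qed
  also have "lp_norm p \<mu> \<dots> \<le> lp_norm p \<mu> (\<lambda>x. r / (l + r) * (f x - ?v x))
      + lp_norm p \<mu> (\<lambda>x. l / (l + r) * (?u x - g x))"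
    by (intro lp_norm_triangle[where \<mu> = \<mu>, OF p \<mu>_pos] lp_space_cmult admissible_diff_lp[of C] f g uv)
  also have "\<dots> = r / (l + r) * lp_norm p \<mu> (\<lambda>x. f x - ?v x) + l / (l + r) * lp_norm p \<mu> (\<lambda>x. ?u x - g x)"
    using t by (simp only: lp_norm_cmult[where \<mu> = \<mu>, OF p \<mu>_pos] abs_of_nonneg)
  finally have "(l + r) * lp_norm p \<mu> (\<lambda>x. ?u x - ?v x) \<le> (l + r) * (r / (l + r) * lp_norm p \<mu> (\<lambda>x. f x - ?v x)
      + l / (l + r) * lp_norm p \<mu> (\<lambda>x. ?u x - g x))"
    using l r by simp
  also have "\<dots> = r * lp_norm p \<mu> (\<lambda>x. f x - ?v x) + l * lp_norm p \<mu> (\<lambda>x. ?u x - g x)"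
    using l r by (simp add: distrib_left)
  finally show ?thesis .
qed

text \<open>Pointwise convergence is immediate from the equation, and the resolvent does not increase the norm; for
  \<open>\<ell>\<^sup>p\<close> these two facts already imply strong convergence.\<close>

lemma res_tendsto_identity:
  assumes f: "admissible C f" and s: "\<And>n. 0 < s n" "s \<longlonglongrightarrow> 0"
  shows "(\<lambda>n. lp_norm p \<mu> (\<lambda>x. res (s n) f x - f x)) \<longlonglongrightarrow> 0"
proof (rule lp_tendsto_if_pointwise_and_norm_le[OF p \<mu>_pos admissibleD(1,2)[OF f]])
  fix x
  have "(\<lambda>n. res (s n) f x - f x) \<longlonglongrightarrow> 0"
  proof (rule Lim_null_comparison)
    show "\<forall>\<^sub>F n in sequentially. norm (res (s n) f x - f x) \<le> s n * (C * rate x + C powr q)"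
    proof (intro always_eventually allI)
      fix n
      let ?v = "res (s n) f"
      note v = admissible_res_facts[OF s(1) f, of n]
      have "0 \<le> nbr ?v x" "nbr ?v x \<le> C * rate x"
        using v by (auto intro: nbr_nonneg nbr_le_rate)
      moreover have "0 \<le> rate x * ?v x" "rate x * ?v x \<le> C * rate x"
        using v(1,2)[of x] rate_nonneg[of x] by (auto simp: mult.commute[of C] intro: mult_left_mono)
      moreover have "?v x powr q \<le> C powr q" "0 \<le> ?v x powr q"
        using v(1,2)[of x] q_pos by (auto intro: powr_mono2)
      ultimately have "\<bar>nbr ?v x - rate x * ?v x - ?v x powr q\<bar> \<le> C * rate x + C powr q"
        by linarith
      then have "s n * \<bar>nbr ?v x - rate x * ?v x - ?v x powr q\<bar> \<le> s n * (C * rate x + C powr q)"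
        using s(1)[of n] by simp
      moreover have "?v x - f x = s n * (nbr ?v x - rate x * ?v x - ?v x powr q)"
        using v(3)[of x] by (simp add: algebra_simps)
      ultimately show "norm (?v x - f x) \<le> s n * (C * rate x + C powr q)"
        using s(1)[of n] by (simp add: abs_mult)
    qed
    show "(\<lambda>n. s n * (C * rate x + C powr q)) \<longlonglongrightarrow> 0"
      using tendsto_mult_right[OF s(2), of "C * rate x + C powr q"] by simp
  qed
  then show "(\<lambda>n. res (s n) f x) \<longlonglongrightarrow> f x" by (simp add: LIM_zero_iff)
qed (use admissible_res[OF s(1) f] admissible_res_facts[OF s(1) f] in \<open>auto simp: admissible_def\<close>)

lemma res_identity_approximation:
  assumes f: "admissible C f" and e: "0 < e"
  obtains s where "0 < s" "lp_norm p \<mu> (\<lambda>x. res s f x - f x) < e"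
proof -
  have "\<forall>\<^sub>F n in sequentially. lp_norm p \<mu> (\<lambda>x. res (inverse (real (Suc n))) f x - f x) < e"
    using e by (intro order_tendstoD(2)[OF res_tendsto_identity[OF f _ LIMSEQ_inverse_real_of_nat]]) auto
  then obtain n where "lp_norm p \<mu> (\<lambda>x. res (inverse (real (Suc n))) f x - f x) < e"
    by (auto simp: eventually_sequentially)
  then show thesis by (intro that[of "inverse (real (Suc n))"]) auto
qed

definition euler :: "real \<Rightarrow> nat \<Rightarrow> ('a \<Rightarrow> real) \<Rightarrow> 'a \<Rightarrow> real" where
  "euler l k f = (res l ^^ k) f"

lemma euler_0 [simp]: "euler l 0 f = f"
  and euler_Suc: "euler l (Suc k) f = res l (euler l k f)"
  by (auto simp: euler_def)

lemma admissible_euler: "0 < l \<Longrightarrow> admissible C f \<Longrightarrow> admissible C (euler l k f)"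
  by (induction k) (auto simp: euler_Suc intro: admissible_res)

lemma lp_norm_euler_diff_le:
  assumes l: "0 < l" and f: "admissible C f" and g: "admissible C g"
  shows "lp_norm p \<mu> (\<lambda>x. euler l k f x - euler l k g x) \<le> lp_norm p \<mu> (\<lambda>x. f x - g x)"
proof (induction k)
  case (Suc k)
  then show ?case
    using lp_norm_res_diff_le(1)[OF l admissible_euler[OF l f] admissible_euler[OF l g], of k k]
    by (simp add: euler_Suc)
qed simp

text \<open>The datum \<open>f\<close> need not lie in the domain of the operator, so it is compared with \<open>res s f\<close>, which does:
  there the difference quotient \<open>(res s f - f) / s\<close> controls the speed of the scheme.\<close>

lemma euler_near_start:
  assumes l: "0 < l" "l \<le> s" and f: "admissible C f"
    and \<delta>: "lp_norm p \<mu> (\<lambda>x. res s f x - f x) \<le> \<delta>"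
  shows "lp_norm p \<mu> (\<lambda>x. euler l k f x - f x) \<le> 2 * \<delta> + \<delta> / s * (real k * l)"
proof -
  have s: "0 < s" using l by linarith
  let ?x = "res s f"
  note x = admissible_res(1)[OF s f]
  note ax = admissible_euler[OF l(1) x] and af = admissible_euler[OF l(1) f]
  have one: "lp_norm p \<mu> (\<lambda>y. res l ?x y - ?x y) \<le> \<delta> / s * l"
  proof -
    let ?g = "\<lambda>y. (1 - l / s) * ?x y + l / s * f y"
    have g: "admissible C ?g" using l s by (intro admissible_convex x f) auto
    have "lp_norm p \<mu> (\<lambda>y. res l ?x y - ?x y) = lp_norm p \<mu> (\<lambda>y. res l ?x y - res l ?g y)"
      unfolding res_identity[OF l f] ..
    also have "\<dots> \<le> lp_norm p \<mu> (\<lambda>y. ?x y - ?g y)"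
      by (rule lp_norm_res_diff_le(1)[OF l(1) x g])
    also have "(\<lambda>y. ?x y - ?g y) = (\<lambda>y. l / s * (?x y - f y))"
      by (simp add: algebra_simps)
    also have "lp_norm p \<mu> \<dots> = l / s * lp_norm p \<mu> (\<lambda>y. ?x y - f y)"
      using l s by (subst lp_norm_cmult[where \<mu> = \<mu>, OF p \<mu>_pos]) auto
    also have "\<dots> \<le> l / s * \<delta>" using \<delta> l s by (intro mult_left_mono) auto
    finally show ?thesis by (simp add: mult.commute)
  qed
  have many: "lp_norm p \<mu> (\<lambda>y. euler l k ?x y - ?x y) \<le> \<delta> / s * (real k * l)" for k
  proof (induction k)
    case 0
    then show ?case using p by (simp add: lp_norm_def)
  next
    case (Suc k)
    have "lp_norm p \<mu> (\<lambda>y. euler l (Suc k) ?x y - ?x y)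
        \<le> lp_norm p \<mu> (\<lambda>y. res l (euler l k ?x) y - res l ?x y) + lp_norm p \<mu> (\<lambda>y. res l ?x y - ?x y)"
      unfolding euler_Suc
      by (intro lp_triangle admissibleD(1)[OF x] admissibleD(1)[OF admissible_res(1)[OF l(1) x]]
          admissibleD(1)[OF admissible_res(1)[OF l(1) ax]])
    also have "\<dots> \<le> \<delta> / s * (real k * l) + \<delta> / s * l"
      using lp_norm_res_diff_le(1)[OF l(1) ax x, of k] Suc one by linarith
    finally show ?case by (simp add: algebra_simps)
  qed
  have "lp_norm p \<mu> (\<lambda>y. euler l k f y - f y)
      \<le> lp_norm p \<mu> (\<lambda>y. euler l k f y - euler l k ?x y) + lp_norm p \<mu> (\<lambda>y. euler l k ?x y - f y)"
    by (intro lp_triangle admissibleD(1)[OF af] admissibleD(1)[OF ax] admissibleD(1)[OF f])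
  also have "lp_norm p \<mu> (\<lambda>y. euler l k ?x y - f y)
      \<le> lp_norm p \<mu> (\<lambda>y. euler l k ?x y - ?x y) + lp_norm p \<mu> (\<lambda>y. ?x y - f y)"
    by (intro lp_triangle admissibleD(1)[OF x] admissibleD(1)[OF ax] admissibleD(1)[OF f])
  finally show ?thesis
    using lp_norm_euler_diff_le[OF l(1) f x, of k] many[of k] \<delta>
      lp_norm_minus_commute[of p \<mu> f ?x] by linarith
qed

lemma euler_difference:
  assumes l: "0 < l" "l \<le> s" and r: "0 < r" "r \<le> s" and \<eta>: "0 < \<eta>" and f: "admissible C f"
    and \<delta>: "lp_norm p \<mu> (\<lambda>x. res s f x - f x) \<le> \<delta>"
  shows "lp_norm p \<mu> (\<lambda>x. euler l i f x - euler r j f x)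
    \<le> 2 * \<delta> + \<delta> / s * (\<eta> + ((real i * l - real j * r)\<^sup>2 + real i * l\<^sup>2 + real j * r\<^sup>2) / \<eta>)"
proof (rule double_sequence_bound[OF l(1) r(1) \<eta>])
  have "0 \<le> \<delta>" using \<delta> lp_norm_nonneg order_trans by blast
  then show "0 \<le> \<delta> / s" using l by simp
  show "lp_norm p \<mu> (\<lambda>x. euler l i f x - euler r 0 f x) \<le> 2 * \<delta> + \<delta> / s * (real i * l)" for i
    using euler_near_start[OF l f \<delta>] by simp
  show "lp_norm p \<mu> (\<lambda>x. euler l 0 f x - euler r j f x) \<le> 2 * \<delta> + \<delta> / s * (real j * r)" for j
    using euler_near_start[OF r f \<delta>] lp_norm_minus_commute[of p \<mu> f] by simp
  show "(l + r) * lp_norm p \<mu> (\<lambda>x. euler l (Suc i) f x - euler r (Suc j) f x)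
      \<le> r * lp_norm p \<mu> (\<lambda>x. euler l i f x - euler r (Suc j) f x)
        + l * lp_norm p \<mu> (\<lambda>x. euler l (Suc i) f x - euler r j f x)" for i j
    unfolding euler_Suc by (rule two_step_inequality[OF l(1) r(1) admissible_euler[OF l(1) f]
      admissible_euler[OF r(1) f]])
qed

text \<open>Uniform closeness of two schemes at two nearby times. The single statement contains convergence as the meshes
  tend to zero and equicontinuity in time.\<close>

lemma euler_cauchy:
  assumes f: "admissible C f" and \<epsilon>: "0 < \<epsilon>" and T: "0 \<le> T"
  obtains \<rho> where "0 < \<rho>"
    "\<And>l r t t'. \<lbrakk>0 < l; l \<le> \<rho>; 0 < r; r \<le> \<rho>; t \<in> {0..T}; t' \<in> {0..T}; \<bar>t - t'\<bar> \<le> \<rho>\<rbrakk> \<Longrightarrow>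
      lp_norm p \<mu> (\<lambda>x. euler l (grid_index l t) f x - euler r (grid_index r t') f x) \<le> \<epsilon>"
proof -
  obtain s where s: "0 < s" "lp_norm p \<mu> (\<lambda>x. res s f x - f x) < \<epsilon> / 6"
    using res_identity_approximation[OF f, of "\<epsilon> / 6"] \<epsilon> by auto
  \<comment> \<open>The bound of \<open>euler_difference\<close> has three terms, and each is made at most \<open>\<epsilon> / 3\<close>: the first by the
    choice of \<open>s\<close>, the second by \<open>\<eta>\<close>, and the quadratic one by \<open>\<rho>\<close>, where \<open>11 = 9 + 2\<close> collects
    \<open>(3 \<rho>)\<^sup>2 \<le> 9 \<rho>\<close> and twice \<open>(T + 1) \<rho>\<close>.\<close>
  define B where "B = \<epsilon> / 6 / s"
  have B: "0 < B" using \<epsilon> s by (simp add: B_def)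
  define \<eta> where "\<eta> = \<epsilon> / (3 * B)"
  have \<eta>: "0 < \<eta>" "B * \<eta> = \<epsilon> / 3" using \<epsilon> B by (auto simp: \<eta>_def)
  define \<rho> where "\<rho> = min (min 1 s) (\<epsilon> * \<eta> / (3 * B * (2 * T + 11)))"
  have \<rho>: "0 < \<rho>" "\<rho> \<le> 1" "\<rho> \<le> s"
    using \<epsilon> s \<eta> B T by (auto simp: \<rho>_def)
  have "\<rho> \<le> \<epsilon> * \<eta> / (3 * B * (2 * T + 11))" by (simp add: \<rho>_def)
  then have \<rho>4: "B * ((2 * T + 11) * \<rho> / \<eta>) \<le> \<epsilon> / 3"
  proof -
    have pos: "0 < 3 * B * (2 * T + 11)" using B T by simp
    have "\<rho> * (3 * B * (2 * T + 11)) \<le> \<epsilon> * \<eta>"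
      using pos \<open>\<rho> \<le> \<epsilon> * \<eta> / (3 * B * (2 * T + 11))\<close> by (simp only: pos_le_divide_eq)
    then have "B * ((2 * T + 11) * \<rho>) / \<eta> \<le> \<epsilon> / 3"
      unfolding pos_divide_le_eq[OF \<eta>(1)] by (simp add: algebra_simps)
    then show ?thesis by simp
  qed
  show thesis
  proof (rule that[OF \<rho>(1)])
    fix l r t t' :: real
    assume l: "0 < l" "l \<le> \<rho>" and r: "0 < r" "r \<le> \<rho>" and t: "t \<in> {0..T}" "t' \<in> {0..T}"
      and tt: "\<bar>t - t'\<bar> \<le> \<rho>"
    define i j where "i = grid_index l t" and "j = grid_index r t'"
    have i: "t \<le> real i * l" "real i * l < t + l" and j: "t' \<le> real j * r" "real j * r < t' + r"
      unfolding i_def j_def using grid_index_bounds[of l t] grid_index_bounds[of r t'] l r t by auto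
    have "\<bar>real i * l - real j * r\<bar> \<le> 3 * \<rho>" using i j l r tt by linarith
    then have "(real i * l - real j * r)\<^sup>2 \<le> (3 * \<rho>)\<^sup>2"
      by (metis abs_ge_zero power2_abs power_mono)
    also have "\<dots> = 9 * (\<rho> * \<rho>)" by (simp add: power2_eq_square)
    also have "\<dots> \<le> 9 * (1 * \<rho>)" using \<rho> by (intro mult_left_mono mult_right_mono) auto
    finally have d: "(real i * l - real j * r)\<^sup>2 \<le> 9 * \<rho>" by simp
    have il: "real i * l\<^sup>2 \<le> (T + 1) * \<rho>"
    proof -
      have "real i * l * l \<le> (T + 1) * \<rho>"
        using i l t \<rho> by (intro mult_mono) auto
      then show ?thesis by (simp add: power2_eq_square mult.assoc)
    qed
    have jr: "real j * r\<^sup>2 \<le> (T + 1) * \<rho>"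
    proof -
      have "real j * r * r \<le> (T + 1) * \<rho>"
        using j r t \<rho> by (intro mult_mono) auto
      then show ?thesis by (simp add: power2_eq_square mult.assoc)
    qed
    have "(real i * l - real j * r)\<^sup>2 + real i * l\<^sup>2 + real j * r\<^sup>2 \<le> (2 * T + 11) * \<rho>"
      using d il jr by (simp add: algebra_simps)
    then have q: "B * (\<eta> + ((real i * l - real j * r)\<^sup>2 + real i * l\<^sup>2 + real j * r\<^sup>2) / \<eta>)
        \<le> B * (\<eta> + (2 * T + 11) * \<rho> / \<eta>)"
      using B \<eta> by (intro mult_left_mono add_left_mono divide_right_mono) auto
    have "lp_norm p \<mu> (\<lambda>x. euler l i f x - euler r j f x)
        \<le> 2 * (\<epsilon> / 6) + \<epsilon> / 6 / s * (\<eta> + ((real i * l - real j * r)\<^sup>2 + real i * l\<^sup>2 + real j * r\<^sup>2) / \<eta>)"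
      using l r \<rho> s \<eta> f by (intro euler_difference[where C = C]) auto
    also have "\<dots> \<le> \<epsilon>"
      using q \<rho>4 \<eta>(2) unfolding B_def[symmetric] distrib_left[of B \<eta>] by linarith
    finally show "lp_norm p \<mu> (\<lambda>x. euler l (grid_index l t) f x - euler r (grid_index r t') f x) \<le> \<epsilon>"
      unfolding i_def j_def .
  qed
qed

section \<open>The limit is a mild solution\<close>

text \<open>The Crandall-Liggett limit along the uniform meshes \<open>1 / Suc n\<close>, taken at each node.\<close>

definition flow :: "('a \<Rightarrow> real) \<Rightarrow> real \<Rightarrow> 'a \<Rightarrow> real" where
  "flow f t x = lim (\<lambda>n. euler (mesh n) (grid_index (mesh n) t) f x)"

lemma flow_0: "flow f 0 = f"
  by (rule ext) (simp add: flow_def grid_index_def)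

lemma flow_tendsto:
  assumes f: "admissible C f" and t: "0 \<le> t"
  shows "(\<lambda>n. euler (mesh n) (grid_index (mesh n) t) f x) \<longlonglongrightarrow> flow f t x"
proof -
  let ?e = "\<lambda>n. euler (mesh n) (grid_index (mesh n) t) f"
  have "Cauchy (\<lambda>n. ?e n x)"
  proof (rule CauchyI)
    fix e :: real assume e: "0 < e"
    let ?m = "\<mu> x powr (1 / p)"
    have m: "0 < ?m" using \<mu>_pos[of x] by simp
    obtain \<rho> where \<rho>: "0 < \<rho>"
      "\<And>l r t' t''. \<lbrakk>0 < l; l \<le> \<rho>; 0 < r; r \<le> \<rho>; t' \<in> {0..t}; t'' \<in> {0..t}; \<bar>t' - t''\<bar> \<le> \<rho>\<rbrakk> \<Longrightarrow>
      lp_norm p \<mu> (\<lambda>x. euler l (grid_index l t') f x - euler r (grid_index r t'') f x) \<le> e * ?m / 2"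
      using euler_cauchy[OF f, of "e * ?m / 2" t] e t m by auto
    obtain N where N: "\<And>n. N \<le> n \<Longrightarrow> mesh n \<le> \<rho>"
      using eventually_mesh_le[OF \<rho>(1)] by (auto simp: eventually_sequentially)
    show "\<exists>N. \<forall>m\<ge>N. \<forall>n\<ge>N. norm (?e m x - ?e n x) < e"
    proof (intro exI allI impI)
      fix i j assume "N \<le> i" "N \<le> j"
      have "\<bar>?e i x - ?e j x\<bar> * ?m \<le> lp_norm p \<mu> (\<lambda>x. ?e i x - ?e j x)"
        by (rule abs_le_lp_norm[where \<mu> = \<mu>, OF p \<mu>_pos
          admissible_diff_lp[OF admissible_euler[OF mesh_pos f] admissible_euler[OF mesh_pos f]]])
      also have "\<dots> \<le> e * ?m / 2"
        using \<rho> N \<open>N \<le> i\<close> \<open>N \<le> j\<close> mesh_pos t by auto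
      also have "\<dots> < e * ?m" using e m by simp
      finally show "norm (?e i x - ?e j x) < e" using m by simp
    qed
  qed
  then show ?thesis
    unfolding flow_def using Cauchy_convergent convergent_LIMSEQ_iff by blast
qed

lemma flow_range:
  assumes f: "admissible C f" and t: "0 \<le> t"
  shows "0 \<le> flow f t x" "flow f t x \<le> C"
  using flow_tendsto[OF assms, of x] admissibleD(2,3)[OF admissible_euler[OF mesh_pos f]]
  by (auto intro: LIMSEQ_le_const LIMSEQ_le_const2)

lemma flow_near_euler:
  assumes f: "admissible C f" and \<epsilon>: "0 < \<epsilon>" and T: "0 \<le> T"
  obtains \<rho> where "0 < \<rho>"
    "\<And>l t t'. \<lbrakk>0 < l; l \<le> \<rho>; t \<in> {0..T}; t' \<in> {0..T}; \<bar>t - t'\<bar> \<le> \<rho>\<rbrakk> \<Longrightarrow>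
      (\<lambda>x. euler l (grid_index l t) f x - flow f t' x) \<in> lp_space p \<mu> \<and>
      lp_norm p \<mu> (\<lambda>x. euler l (grid_index l t) f x - flow f t' x) \<le> \<epsilon>"
proof -
  obtain \<rho> where \<rho>: "0 < \<rho>"
    "\<And>l r t t'. \<lbrakk>0 < l; l \<le> \<rho>; 0 < r; r \<le> \<rho>; t \<in> {0..T}; t' \<in> {0..T}; \<bar>t - t'\<bar> \<le> \<rho>\<rbrakk> \<Longrightarrow>
      lp_norm p \<mu> (\<lambda>x. euler l (grid_index l t) f x - euler r (grid_index r t') f x) \<le> \<epsilon>"
    using euler_cauchy[OF assms] by blast
  show thesis
  proof (rule that[OF \<rho>(1)])
    fix l t t' assume A: "0 < l" "l \<le> \<rho>" "t \<in> {0..T}" "t' \<in> {0..T}" "\<bar>t - t'\<bar> \<le> \<rho>"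
    show "(\<lambda>x. euler l (grid_index l t) f x - flow f t' x) \<in> lp_space p \<mu> \<and>
      lp_norm p \<mu> (\<lambda>x. euler l (grid_index l t) f x - flow f t' x) \<le> \<epsilon>"
    proof (rule lp_fatou[where \<mu> = \<mu> and
          z = "\<lambda>n x. euler l (grid_index l t) f x - euler (mesh n) (grid_index (mesh n) t') f x",
          OF p \<mu>_pos])
      show "(\<lambda>n. euler l (grid_index l t) f x - euler (mesh n) (grid_index (mesh n) t') f x)
          \<longlonglongrightarrow> euler l (grid_index l t) f x - flow f t' x" for x
        using A by (intro tendsto_intros flow_tendsto[OF f]) auto
      show "\<forall>\<^sub>F n in sequentially.
          (\<lambda>x. euler l (grid_index l t) f x - euler (mesh n) (grid_index (mesh n) t') f x) \<in> lp_space p \<mu> \<and>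
          lp_norm p \<mu> (\<lambda>x. euler l (grid_index l t) f x - euler (mesh n) (grid_index (mesh n) t') f x) \<le> \<epsilon>"
        using eventually_mesh_le[OF \<rho>(1)]
      proof eventually_elim
        case (elim n)
        then show ?case
          using A \<rho>(2) mesh_pos admissible_diff_lp[OF admissible_euler[OF A(1) f] admissible_euler[OF mesh_pos f]]
          by auto
      qed
    qed (use \<epsilon> in simp)
  qed
qed

lemma flow_lp:
  assumes f: "admissible C f" and t: "0 \<le> t"
  shows "flow f t \<in> lp_space p \<mu>"
proof -
  obtain \<rho> where \<rho>: "0 < \<rho>"
    "\<And>l t' t''. \<lbrakk>0 < l; l \<le> \<rho>; t' \<in> {0..t}; t'' \<in> {0..t}; \<bar>t' - t''\<bar> \<le> \<rho>\<rbrakk> \<Longrightarrow>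
      (\<lambda>x. euler l (grid_index l t') f x - flow f t'' x) \<in> lp_space p \<mu> \<and>
      lp_norm p \<mu> (\<lambda>x. euler l (grid_index l t') f x - flow f t'' x) \<le> 1"
    using flow_near_euler[OF f, of 1 t] t by auto
  have "(\<lambda>x. euler \<rho> (grid_index \<rho> t) f x - flow f t x) \<in> lp_space p \<mu>"
    using \<rho>(2)[of \<rho> t t] \<rho>(1) t by auto
  from lp_diff[OF admissibleD(1)[OF admissible_euler[OF \<rho>(1) f, of "grid_index \<rho> t"]] this]
  show ?thesis by simp
qed

lemma flow_continuous:
  assumes f: "admissible C f" and s: "s \<in> {0..T}"
  shows "((\<lambda>r. lp_norm p \<mu> (\<lambda>x. flow f r x - flow f s x)) \<longlongrightarrow> 0) (at s within {0..T})"
proof (rule tendstoI)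
  fix e :: real assume e: "0 < e"
  obtain \<rho> where \<rho>: "0 < \<rho>"
    "\<And>l t t'. \<lbrakk>0 < l; l \<le> \<rho>; t \<in> {0..T}; t' \<in> {0..T}; \<bar>t - t'\<bar> \<le> \<rho>\<rbrakk> \<Longrightarrow>
      (\<lambda>x. euler l (grid_index l t) f x - flow f t' x) \<in> lp_space p \<mu> \<and>
      lp_norm p \<mu> (\<lambda>x. euler l (grid_index l t) f x - flow f t' x) \<le> e / 3"
    using flow_near_euler[OF f, of "e / 3" T] s e by auto
  have "lp_norm p \<mu> (\<lambda>x. flow f r x - flow f s x) < e" if r: "r \<in> {0..T}" "dist r s < \<rho>" for r
  proof -
    let ?u = "euler \<rho> (grid_index \<rho> s) f"
    have "lp_norm p \<mu> (\<lambda>x. flow f r x - flow f s x)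
        \<le> lp_norm p \<mu> (\<lambda>x. flow f r x - ?u x) + lp_norm p \<mu> (\<lambda>x. ?u x - flow f s x)"
      using r s by (intro lp_triangle flow_lp[OF f] admissibleD(1)[OF admissible_euler[OF \<rho>(1) f]]) auto
    also have "\<dots> \<le> e / 3 + e / 3"
      using \<rho>(2)[of \<rho> s r] \<rho>(2)[of \<rho> s s] \<rho>(1) r s lp_norm_minus_commute[of p \<mu> ?u "flow f r"]
      by (auto simp: dist_real_def abs_minus_commute)
    also have "\<dots> < e" using e by simp
    finally show ?thesis .
  qed
  then show "\<forall>\<^sub>F r in at s within {0..T}. dist (lp_norm p \<mu> (\<lambda>x. flow f r x - flow f s x)) 0 < e"
    unfolding eventually_at using \<rho>(1) by (auto intro!: exI[of _ \<rho>])
qed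

text \<open>The schemes whose limit defines the flow are themselves the approximate solutions, with a uniform
  partition and no discretization error in the zero right-hand side.\<close>

lemma flow_mild_solution:
  assumes f: "admissible C f"
  shows "mild_solution w \<kappa> \<mu> p q (\<lambda>t x. 0) f (flow f)"
  unfolding mild_solution_def mild_solution_on_def
proof (intro allI impI conjI ballI)
  fix a :: real assume a: "0 < a"
  show zero: "(\<lambda>x. 0) \<in> lp_space p \<mu>" using p by (simp add: lp_space_def)
  fix s assume s: "s \<in> {0..a}"
  show "flow f s \<in> lp_space p \<mu>" using flow_lp[OF f] s by simp
  show "((\<lambda>r. lp_norm p \<mu> (\<lambda>x. flow f r x - flow f s x)) \<longlongrightarrow> 0) (at s within {0..a})"
    by (rule flow_continuous[OF f s])
next
  fix a \<epsilon> :: real assume a: "0 < a" and \<epsilon>: "0 < \<epsilon>"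
  obtain \<rho> where \<rho>: "0 < \<rho>"
    "\<And>l t t'. \<lbrakk>0 < l; l \<le> \<rho>; t \<in> {0..a}; t' \<in> {0..a}; \<bar>t - t'\<bar> \<le> \<rho>\<rbrakk> \<Longrightarrow>
      (\<lambda>x. euler l (grid_index l t) f x - flow f t' x) \<in> lp_space p \<mu> \<and>
      lp_norm p \<mu> (\<lambda>x. euler l (grid_index l t) f x - flow f t' x) \<le> \<epsilon> / 2"
    using flow_near_euler[OF f, of "\<epsilon> / 2" a] a \<epsilon> by auto
  \<comment> \<open>\<open>l \<le> a\<close> ensures that the partition has at least one step.\<close>
  define l where "l = min \<rho> (min \<epsilon> a)"
  have l: "0 < l" "l \<le> \<rho>" "l \<le> \<epsilon>" "l \<le> a" using \<rho> a \<epsilon> by (auto simp: l_def)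
  define N where "N = nat \<lfloor>a / l\<rfloor>"
  have "1 \<le> a / l" using l by simp
  then have fl: "1 \<le> \<lfloor>a / l\<rfloor>" by simp
  have N: "1 \<le> N" using fl unfolding N_def by linarith
  have "real N = of_int \<lfloor>a / l\<rfloor>" using fl by (simp add: N_def)
  then have Na: "real N \<le> a / l" "a / l < real N + 1" by linarith+
  then have Nl: "real N * l \<le> a" "a < real N * l + l"
    using l by (auto simp: field_simps)
  have zero: "(\<lambda>x. 0) \<in> lp_space p \<mu>" using p by (simp add: lp_space_def)
  have nz: "lp_norm p \<mu> (\<lambda>x. 0) = 0" using p by (simp add: lp_norm_def)
  show "\<exists>N t hs v. eps_discretization \<mu> p a (\<lambda>t x. 0) \<epsilon> N t hs \<and>
      approx_solution w \<kappa> \<mu> p q f N t hs v \<and>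
      (\<forall>s\<in>{0..t N}. lp_norm p \<mu> (\<lambda>x. flow f s x - v s x) < \<epsilon>)"
  proof (intro exI conjI)
    show "eps_discretization \<mu> p a (\<lambda>t x. 0) \<epsilon> N (\<lambda>k. real k * l) (\<lambda>k x. 0)"
      unfolding eps_discretization_def using N Nl l zero \<epsilon>
      by (auto simp: nz of_nat_diff algebra_simps)
    show "approx_solution w \<kappa> \<mu> p q f N (\<lambda>k. real k * l) (\<lambda>k x. 0)
        (\<lambda>s. euler l (grid_index l s) f)"
      unfolding approx_solution_def
    proof (intro exI conjI ballI allI)
      fix k assume k: "k \<in> {1..N}"
      then obtain k' where k': "k = Suc k'" by (cases k) auto
      have d: "real k * l - real (k - 1) * l = l" unfolding k' by (simp add: algebra_simps)
      show "euler l k f \<in> op_A_dom w \<kappa> \<mu> p q"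
        unfolding k' euler_Suc by (rule res_op_A_dom(1)[OF l(1) admissible_euler[OF l(1) f]])
      show "euler l k f x + (real k * l - real (k - 1) * l) * op_A w \<kappa> \<mu> q (euler l k f) x
          = euler l (k - 1) f x + (real k * l - real (k - 1) * l) * 0" for x
        unfolding d unfolding k' euler_Suc
        using res_op_A_dom(2)[OF l(1) admissible_euler[OF l(1) f]] by simp
      show "euler l (grid_index l s) f = euler l k f" if "s \<in> {real (k - 1) * l<..real k * l}" for s
        using grid_index_eq[OF l(1), of k s] k that by simp
    qed (simp_all add: grid_index_def)
    show "\<forall>s\<in>{0..real N * l}. lp_norm p \<mu> (\<lambda>x. flow f s x - euler l (grid_index l s) f x) < \<epsilon>"
    proof
      fix s assume "s \<in> {0..real N * l}"
      then have "lp_norm p \<mu> (\<lambda>x. euler l (grid_index l s) f x - flow f s x) \<le> \<epsilon> / 2"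
        using \<rho>(2)[of l s s] \<rho>(1) l Nl by auto
      then show "lp_norm p \<mu> (\<lambda>x. flow f s x - euler l (grid_index l s) f x) < \<epsilon>"
        using \<epsilon> lp_norm_minus_commute[of p \<mu> "flow f s" "euler l (grid_index l s) f"] by simp
    qed
  qed
qed

section \<open>Decay and extinction\<close>

lemma euler_le_scalar_euler:
  assumes l: "0 < l" and f: "admissible C f"
  shows "euler l k f x \<le> scalar_euler l C k"
proof (induction k arbitrary: x)
  case 0
  then show ?case using admissibleD(3)[OF f] by simp
next
  case (Suc k)
  note c = scalar_euler_facts[OF l admissibleD(4)[OF f]]
  have nn: "0 \<le> euler l k f x" for x
    using admissibleD(2)[OF admissible_euler[OF l f]] .
  show ?case
    unfolding euler_Suc using Suc by (intro res_le[where f = "euler l k f", OF l nn c(1)]) (simp only: c(2))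
qed

text \<open>The clock bound passes to the limit at any node where the limit is positive: half that value serves
  as the threshold \<open>\<eta>\<close>, below which the scheme eventually does not fall.\<close>

lemma flow_clock_bound:
  assumes q1: "q \<noteq> 1" and f: "admissible C f" and t: "0 \<le> t" and pos: "0 < flow f t x"
  shows "0 < C" "absorption_clock (flow f t x) \<le> absorption_clock C - t"
proof -
  show "0 < C" using flow_range(2)[OF f t, of x] pos by linarith
  define \<eta> where "\<eta> = flow f t x / 2"
  have \<eta>: "0 < \<eta>" "\<eta> < flow f t x" using pos by (auto simp: \<eta>_def)
  define B where "B = max (\<eta> powr (q - 1)) (C powr (q - 1))"
  let ?k = "\<lambda>n. grid_index (mesh n) t"
  let ?u = "\<lambda>n. euler (mesh n) (?k n) f x"
  note lim = flow_tendsto[OF f t, of x]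
  show "absorption_clock (flow f t x) \<le> absorption_clock C - t"
  proof (rule tendsto_le)
    show "(\<lambda>n. absorption_clock (?u n)) \<longlonglongrightarrow> absorption_clock (flow f t x)"
      unfolding absorption_clock_def using pos q1 by (intro tendsto_intros lim) auto
    have "(\<lambda>n. absorption_clock C - (real (?k n) * mesh n) * (1 + mesh n * B) powr (- q))
        \<longlonglongrightarrow> absorption_clock C - t * (1 + 0 * B) powr (- q)"
      by (intro tendsto_intros grid_time_tendsto t mesh_lim) auto
    then show "(\<lambda>n. absorption_clock C - (real (?k n) * mesh n) * (1 + mesh n * B) powr (- q))
        \<longlonglongrightarrow> absorption_clock C - t" by simp
    show "\<forall>\<^sub>F n in sequentially. absorption_clock (?u n)
        \<le> absorption_clock C - (real (?k n) * mesh n) * (1 + mesh n * B) powr (- q)"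
      using order_tendstoD(1)[OF lim \<eta>(2)]
    proof eventually_elim
      case (elim n)
      have le: "?u n \<le> scalar_euler (mesh n) C (?k n)"
        by (rule euler_le_scalar_euler[OF mesh_pos f])
      then have "absorption_clock (?u n) \<le> absorption_clock (scalar_euler (mesh n) C (?k n))"
        using elim \<eta> by (intro absorption_clock_mono q1) auto
      also have "\<dots> \<le> absorption_clock C - (real (?k n) * mesh n) * (1 + mesh n * B) powr (- q)"
        using elim le
        by (intro scalar_euler_clock[OF q1 mesh_pos admissibleD(4)[OF f] \<eta>(1) B_def]) auto
      finally show ?case .
    qed
  qed simp
qed

lemma flow_upper_bound_sublinear:
  assumes q1: "q < 1" and f: "admissible C f" and t: "0 \<le> t"
  shows "flow f t x \<le> (max (C powr (1 - q) - (1 - q) * t) 0) powr (1 / (1 - q))"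
proof (cases "flow f t x = 0")
  case False
  then have pos: "0 < flow f t x" using flow_range(1)[OF f t, of x] by simp
  have "absorption_clock (flow f t x) \<le> absorption_clock C - t"
    using q1 by (intro flow_clock_bound(2)[OF _ f t pos]) simp
  then have "(1 - q) * (flow f t x powr (1 - q) / (1 - q)) \<le> (1 - q) * (C powr (1 - q) / (1 - q) - t)"
    unfolding absorption_clock_def using q1 by (intro mult_left_mono) auto
  then have "flow f t x powr (1 - q) \<le> C powr (1 - q) - (1 - q) * t"
    using q1 by (simp add: right_diff_distrib)
  then have "(flow f t x powr (1 - q)) powr (1 / (1 - q))
      \<le> (max (C powr (1 - q) - (1 - q) * t) 0) powr (1 / (1 - q))"
    using q1 by (intro powr_mono2) auto
  then show ?thesis using q1 pos by (simp add: powr_powr)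
qed simp

lemma flow_upper_bound_superlinear:
  assumes q1: "1 < q" and f: "admissible C f" and t: "0 \<le> t"
  shows "flow f t x \<le> (1 / C powr (q - 1) + (q - 1) * t) powr (- (1 / (q - 1)))"
proof (cases "flow f t x = 0")
  case False
  then have pos: "0 < flow f t x" using flow_range(1)[OF f t, of x] by simp
  note b = flow_clock_bound[OF _ f t pos]
  have C: "0 < C" using b q1 by simp
  have e: "s powr (1 - q) = 1 / s powr (q - 1)" for s
    using powr_minus_divide[of s "q - 1"] by simp
  have "absorption_clock (flow f t x) \<le> absorption_clock C - t"
    using b q1 by simp
  then have "(q - 1) * (flow f t x powr (1 - q) / (1 - q)) \<le> (q - 1) * (C powr (1 - q) / (1 - q) - t)"
    unfolding absorption_clock_def using q1 by (intro mult_left_mono) auto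
  moreover have "(q - 1) * (s / (1 - q)) = - s" for s using q1 by (simp add: field_simps)
  ultimately have "1 / C powr (q - 1) + (q - 1) * t \<le> flow f t x powr (1 - q)"
    unfolding e[of C, symmetric] by (simp add: right_diff_distrib)
  moreover have "0 < 1 / C powr (q - 1) + (q - 1) * t"
    using C q1 t by (simp add: add_pos_nonneg)
  ultimately have "(flow f t x powr (1 - q)) powr (- (1 / (q - 1)))
      \<le> (1 / C powr (q - 1) + (q - 1) * t) powr (- (1 / (q - 1)))"
    using q1 by (intro powr_mono2') auto
  moreover have "(1 - q) * (- (1 / (q - 1))) = 1" using q1 by (simp add: field_simps)
  ultimately show ?thesis using pos by (simp only: powr_powr) simp
qed simp

section \<open>Strict positivity\<close>

text \<open>For \<open>q > 1\<close> the absorption \<open>v powr q \<le> C powr (q - 1) * v\<close> is at most linear, so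
  positivity decays at a finite exponential rate and never stops. For \<open>q < 1\<close> no such bound exists near zero.\<close>

lemma res_lower:
  assumes q1: "1 < q" and l: "0 < l" and f: "admissible C f" and K: "rate x + C powr (q - 1) \<le> K"
  shows "f x + l * nbr (res l f) x \<le> (1 + l * K) * res l f x"
proof -
  note v = admissible_res_facts[OF l f]
  have "res l f x powr q = res l f x * res l f x powr (q - 1)"
    using v(1)[of x] by (simp add: powr_mult_base)
  also have "\<dots> \<le> res l f x * C powr (q - 1)"
    using v(1,2)[of x] q1 by (intro mult_left_mono powr_mono2) auto
  finally have "l * (rate x * res l f x + res l f x powr q)
      \<le> l * (rate x * res l f x + res l f x * C powr (q - 1))" using l by simp
  also have "\<dots> = l * (rate x + C powr (q - 1)) * res l f x" by (simp add: algebra_simps)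
  also have "\<dots> \<le> l * K * res l f x"
    using l K v(1) by (intro mult_right_mono mult_left_mono) auto
  finally show ?thesis using v(3)[of x] by (simp add: algebra_simps)
qed

lemma euler_lower:
  assumes q1: "1 < q" and l: "0 < l" and f: "admissible C f" and K: "rate x + C powr (q - 1) \<le> K"
  shows "euler l j f x \<le> (1 + l * K) ^ i * euler l (j + i) f x"
proof (induction i)
  case (Suc i)
  note a = admissible_euler[OF l f, of "j + i"]
  have "0 \<le> K" using K rate_nonneg[of x] powr_ge_zero[of C "q - 1"] by linarith
  then have lK: "0 \<le> 1 + l * K" using l by simp
  have "0 \<le> l * nbr (res l (euler l (j + i) f)) x"
    using l admissible_res_facts(1)[OF l a] by (intro mult_nonneg_nonneg nbr_nonneg) auto
  then have "euler l (j + i) f x \<le> (1 + l * K) * euler l (j + Suc i) f x"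
    using res_lower[OF q1 l a K] by (simp add: euler_Suc)
  then have "(1 + l * K) ^ i * euler l (j + i) f x
      \<le> (1 + l * K) ^ i * ((1 + l * K) * euler l (j + Suc i) f x)"
    using lK by (intro mult_left_mono) auto
  then show ?case using Suc by (simp add: mult_ac)
qed simp

text \<open>Positivity spreads along an edge: during \<open>i\<close> steps the node \<open>x\<close> receives from \<open>y\<close> at the rate \<open>w x y / \<mu> x\<close>, while
  both values decay at most like powers of \<open>1 + l * K\<close>. The extra factor absorbs the index shift, as
  the neighbour enters at the new time level.\<close>

lemma euler_lower_neighbour:
  assumes q1: "1 < q" and l: "0 < l" and f: "admissible C f"
    and Kx: "rate x + C powr (q - 1) \<le> K" and Ky: "rate y + C powr (q - 1) \<le> K"
  shows "real i * l * (w x y / \<mu> x) * euler l j f y \<le> (1 + l * K) ^ Suc i * euler l (j + i) f x"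
proof (induction i)
  case 0
  have "0 \<le> K" using Kx rate_nonneg[of x] powr_ge_zero[of C "q - 1"] by linarith
  then show ?case using l admissibleD(2)[OF admissible_euler[OF l f]] by simp
next
  case (Suc i)
  note a = admissible_euler[OF l f]
  define b where "b = w x y / \<mu> x"
  have b: "0 \<le> b" using w_nonneg[of x y] \<mu>_pos[of x] by (simp add: b_def)
  have "0 \<le> K" using Kx rate_nonneg[of x] powr_ge_zero[of C "q - 1"] by linarith
  then have lK: "0 \<le> 1 + l * K" using l by simp
  let ?R = "(1 + l * K) ^ Suc i"
  have "b * euler l (j + Suc i) f y \<le> nbr (euler l (j + Suc i) f) x"
    unfolding b_def by (rule nbr_ge_single[OF admissibleD(2)[OF a] admissibleD(3)[OF a]])
  then have "l * (b * euler l (j + Suc i) f y) \<le> l * nbr (res l (euler l (j + i) f)) x"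
    using l by (simp add: euler_Suc)
  then have "euler l (j + i) f x + l * (b * euler l (j + Suc i) f y)
      \<le> (1 + l * K) * euler l (j + Suc i) f x"
    using res_lower[OF q1 l a[of "j + i"] Kx] by (simp add: euler_Suc)
  then have "?R * (euler l (j + i) f x + l * (b * euler l (j + Suc i) f y))
      \<le> ?R * ((1 + l * K) * euler l (j + Suc i) f x)"
    using lK by (intro mult_left_mono zero_le_power)
  moreover have "l * b * euler l j f y \<le> l * b * (?R * euler l (j + Suc i) f y)"
    using euler_lower[OF q1 l f Ky, of j "Suc i"] l b by (intro mult_left_mono) auto
  ultimately show ?case
    using Suc unfolding b_def[symmetric] by (simp add: algebra_simps)
qed

lemma flow_lower:
  assumes q1: "1 < q" and f: "admissible C f" and K: "rate x + C powr (q - 1) \<le> K"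
    and st: "0 \<le> s" "s \<le> t"
  shows "flow f s x \<le> exp (K * (t - s)) * flow f t x"
proof (rule LIMSEQ_le)
  let ?j = "\<lambda>n. grid_index (mesh n) s" and ?k = "\<lambda>n. grid_index (mesh n) t"
  have K0: "0 \<le> K" using K rate_nonneg[of x] powr_ge_zero[of C "q - 1"] by linarith
  show "(\<lambda>n. euler (mesh n) (?j n) f x) \<longlonglongrightarrow> flow f s x"
    by (rule flow_tendsto[OF f st(1)])
  show "(\<lambda>n. exp (K * (real (?k n) * mesh n - real (?j n) * mesh n)) * euler (mesh n) (?k n) f x)
      \<longlonglongrightarrow> exp (K * (t - s)) * flow f t x"
    using st by (intro tendsto_intros grid_time_tendsto flow_tendsto[OF f]) auto
  show "\<exists>N. \<forall>n\<ge>N. euler (mesh n) (?j n) f x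
      \<le> exp (K * (real (?k n) * mesh n - real (?j n) * mesh n)) * euler (mesh n) (?k n) f x"
  proof (intro exI allI impI)
    fix n
    note l = mesh_pos[of n]
    have jk: "?j n \<le> ?k n" by (rule grid_index_mono[OF l st(2)])
    have "euler (mesh n) (?j n) f x \<le> (1 + mesh n * K) ^ (?k n - ?j n) * euler (mesh n) (?k n) f x"
      using euler_lower[OF q1 l f K, of "?j n" "?k n - ?j n"] jk by simp
    also have "\<dots> \<le> exp (mesh n * K * real (?k n - ?j n)) * euler (mesh n) (?k n) f x"
      using l K0 by (intro mult_right_mono one_plus_power_le_exp admissibleD(2)[OF admissible_euler[OF l f]]) auto
    also have "mesh n * K * real (?k n - ?j n) = K * (real (?k n) * mesh n - real (?j n) * mesh n)"
      using jk by (simp add: of_nat_diff algebra_simps)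
    finally show "euler (mesh n) (?j n) f x
      \<le> exp (K * (real (?k n) * mesh n - real (?j n) * mesh n)) * euler (mesh n) (?k n) f x" .
  qed
qed

lemma flow_lower_neighbour:
  assumes q1: "1 < q" and f: "admissible C f"
    and Kx: "rate x + C powr (q - 1) \<le> K" and Ky: "rate y + C powr (q - 1) \<le> K"
    and st: "0 \<le> s" "s \<le> t"
  shows "(t - s) * (w x y / \<mu> x) * flow f s y \<le> exp (K * (t - s)) * flow f t x"
proof (rule LIMSEQ_le)
  let ?j = "\<lambda>n. grid_index (mesh n) s" and ?k = "\<lambda>n. grid_index (mesh n) t"
  have K0: "0 \<le> K" using Kx rate_nonneg[of x] powr_ge_zero[of C "q - 1"] by linarith
  show "(\<lambda>n. (real (?k n) * mesh n - real (?j n) * mesh n) * (w x y / \<mu> x) * euler (mesh n) (?j n) f y)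
      \<longlonglongrightarrow> (t - s) * (w x y / \<mu> x) * flow f s y"
    using st by (intro tendsto_mult tendsto_diff tendsto_const grid_time_tendsto flow_tendsto[OF f]) auto
  have "(\<lambda>n. exp (K * (mesh n + (real (?k n) * mesh n - real (?j n) * mesh n))) * euler (mesh n) (?k n) f x)
      \<longlonglongrightarrow> exp (K * (0 + (t - s))) * flow f t x"
    using st by (intro tendsto_intros grid_time_tendsto flow_tendsto[OF f] mesh_lim) auto
  then show "(\<lambda>n. exp (K * (mesh n + (real (?k n) * mesh n - real (?j n) * mesh n))) * euler (mesh n) (?k n) f x)
      \<longlonglongrightarrow> exp (K * (t - s)) * flow f t x" by simp
  show "\<exists>N. \<forall>n\<ge>N. (real (?k n) * mesh n - real (?j n) * mesh n) * (w x y / \<mu> x) * euler (mesh n) (?j n) f y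
      \<le> exp (K * (mesh n + (real (?k n) * mesh n - real (?j n) * mesh n))) * euler (mesh n) (?k n) f x"
  proof (intro exI allI impI)
    fix n
    note l = mesh_pos[of n]
    have jk: "?j n \<le> ?k n" by (rule grid_index_mono[OF l st(2)])
    have d: "real (?k n) * mesh n - real (?j n) * mesh n = real (?k n - ?j n) * mesh n"
      using jk by (simp add: of_nat_diff algebra_simps)
    have "real (?k n - ?j n) * mesh n * (w x y / \<mu> x) * euler (mesh n) (?j n) f y
        \<le> (1 + mesh n * K) ^ Suc (?k n - ?j n) * euler (mesh n) (?k n) f x"
      using euler_lower_neighbour[OF q1 l f Kx Ky, of "?k n - ?j n" "?j n"] jk by simp
    also have "\<dots> \<le> exp (mesh n * K * real (Suc (?k n - ?j n))) * euler (mesh n) (?k n) f x"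
      using l K0 by (intro mult_right_mono one_plus_power_le_exp admissibleD(2)[OF admissible_euler[OF l f]]) auto
    also have "mesh n * K * real (Suc (?k n - ?j n)) = K * (mesh n + real (?k n - ?j n) * mesh n)"
      by (simp add: algebra_simps)
    finally show "(real (?k n) * mesh n - real (?j n) * mesh n) * (w x y / \<mu> x) * euler (mesh n) (?j n) f y
      \<le> exp (K * (mesh n + (real (?k n) * mesh n - real (?j n) * mesh n))) * euler (mesh n) (?k n) f x"
      unfolding d .
  qed
qed

text \<open>Each edge of a path from a node with positive datum costs half of the remaining time.\<close>

lemma flow_positive:
  assumes q1: "1 < q" and f: "admissible C f" and x0: "0 < f x0"
    and path: "(\<lambda>a b. 0 < w a b)\<^sup>*\<^sup>* x0 x" and t: "0 < t"
  shows "0 < flow f t x"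
  using path t
proof (induction arbitrary: t rule: rtranclp_induct)
  case base
  have "f x0 \<le> exp ((rate x0 + C powr (q - 1)) * (t - 0)) * flow f t x0"
    using flow_lower[OF q1 f order_refl, of 0 t x0] base by (simp add: flow_0)
  then have "0 < exp ((rate x0 + C powr (q - 1)) * (t - 0)) * flow f t x0" using x0 by linarith
  then show ?case by (simp add: zero_less_mult_iff)
next
  case (step y z)
  define K where "K = max (rate z + C powr (q - 1)) (rate y + C powr (q - 1))"
  have "(t - t / 2) * (w z y / \<mu> z) * flow f (t / 2) y \<le> exp (K * (t - t / 2)) * flow f t z"
    using step.prems by (intro flow_lower_neighbour[OF q1 f]) (auto simp: K_def)
  moreover have "0 < (t - t / 2) * (w z y / \<mu> z) * flow f (t / 2) y"
    using step.prems step.IH[of "t / 2"] step.hyps(2) \<mu>_pos[of z] w_sym[of z y] by simp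
  ultimately have "0 < exp (K * (t - t / 2)) * flow f t z" by linarith
  then show ?case by (simp add: zero_less_mult_iff)
qed

end

section \<open>Bounds for the unique mild solution\<close>

theorem theorem6p2:
  fixes w :: "'a::countable \<Rightarrow> 'a \<Rightarrow> real"
    and \<kappa> \<mu> u0 :: "'a \<Rightarrow> real"
    and p q M :: real
    and u :: "real \<Rightarrow> 'a \<Rightarrow> real"
  assumes "weighted_graph w \<kappa> \<mu>"
    and "graph_connected w"
    and "1 \<le> p"
    and "p > 1 \<Longrightarrow> \<forall>x. (\<lambda>y. w x y powr p / \<mu> y powr (p - 1)) summable_on UNIV"
    and "q \<in> {0<..<1} \<union> {1<..}"
    and "u0 \<in> lp_space p \<mu> \<inter> linf_space"
    and "\<forall>x. 0 \<le> u0 x"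
    and "unique_mild_solution w \<kappa> \<mu> p q (\<lambda>t x. 0) u0 u"
    and "M = linf_norm u0"
  shows "(q \<in> {0<..<1} \<longrightarrow>
            (\<forall>t>0. \<forall>x. 0 \<le> u t x \<and>
               u t x \<le> (max (M powr (1 - q) - (1 - q) * t) 0) powr (1 / (1 - q))))
       \<and> (q \<in> {1<..} \<and> (\<exists>x. u0 x \<noteq> 0) \<longrightarrow>
            (\<forall>t>0. \<forall>x. 0 < u t x \<and>
               u t x \<le> (1 / M powr (q - 1) + (q - 1) * t) powr (- (1 / (q - 1)))))
       \<and> (q \<in> {0<..<1} \<longrightarrow>
            (\<forall>t \<ge> M powr (1 - q) / (1 - q). \<forall>x. u t x = 0))"
proof -
  interpret lp_absorption_graph q w \<kappa> \<mu> p
    by unfold_locales (use assms(1,3,5) in auto)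
  have M: "\<bar>u0 x\<bar> \<le> M" for x
    unfolding assms(9) linf_norm_def
  proof (rule cSUP_upper)
    obtain B where "\<And>x. \<bar>u0 x\<bar> \<le> B"
      using assms(6) by (auto simp: linf_space_def bounded_iff)
    then show "bdd_above (range (\<lambda>x. \<bar>u0 x\<bar>))" by (intro bdd_aboveI[of _ B]) auto
  qed simp
  have adm: "admissible M u0"
    unfolding admissible_def using assms(6,7) order_trans[OF abs_ge_self M] by blast
  have u: "u t = flow u0 t" if "0 \<le> t" for t
    using assms(8) flow_mild_solution[OF adm] that unfolding unique_mild_solution_def by metis
  have sub: "0 \<le> u t x \<and> u t x \<le> (max (M powr (1 - q) - (1 - q) * t) 0) powr (1 / (1 - q))"
    if "q < 1" "0 \<le> t" for t x
    unfolding u[OF that(2)] using flow_range(1)[OF adm that(2)] flow_upper_bound_sublinear[OF that(1) adm that(2)]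
    by blast
  have "u t x = 0" if q1: "q < 1" and t: "M powr (1 - q) / (1 - q) \<le> t" for t x
  proof -
    have "0 \<le> M powr (1 - q) / (1 - q)" using q1 by simp
    then have t0: "0 \<le> t" using t by linarith
    have "M powr (1 - q) - (1 - q) * t \<le> 0"
      using t q1 by (simp add: pos_divide_le_eq mult.commute)
    then show ?thesis using sub[OF q1 t0, of x] by (simp add: max_def split: if_splits)
  qed
  moreover have "0 < u t x \<and> u t x \<le> (1 / M powr (q - 1) + (q - 1) * t) powr (- (1 / (q - 1)))"
    if q1: "1 < q" and x0: "u0 x0 \<noteq> 0" and t: "0 < t" for t x x0
  proof -
    have "0 < u0 x0" using x0 assms(7) by (simp add: order_less_le)
    moreover have "(\<lambda>a b. 0 < w a b)\<^sup>*\<^sup>* x0 x" using assms(2) by (simp add: graph_connected_def)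
    ultimately show ?thesis
      unfolding u[OF less_imp_le[OF t]] using flow_positive[OF q1 adm _ _ t]
        flow_upper_bound_superlinear[OF q1 adm less_imp_le[OF t]] by blast
  qed
  ultimately show ?thesis using sub by auto
qed

end
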